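(* Let $F$ be a field of characteristic different from $2$ with $\sqrt{F}\subseteq F$ (that is, every element of $F$ has a square root in $F$), and let $L$ be a finite-dimensional Leibniz algebra over $F$. Then every subalgebra of $L$ is a weak quasi-ideal of $L$ and $L/\phi(L)$ is an almost abelian Lie algebra if and only if $L=A\dot{+}\langle x\rangle$, where $A\neq 0$ is an abelian ideal of $L$, $\langle x\rangle$ is a nilpotent cyclic Leibniz algebra, and $[a,x]=a$, $[x,a]=-a$, $[x^k,a]=[a,x^k]=0$ for all $a\in A$ and all $k>1$.
   Context: A (right) Leibniz algebra over a field $F$ is a vector space $L$ with a bilinear product $[\cdot,\cdot]$ satisfying $[x,[y,z]]=[[x,y],z]-[[x,z],y]$ for all $x,y,z$. Powers are defined by $x^1=x$, $x^{i+1}=[x^i,x]$. $\langle x\rangle$ denotes the subalgebra generated by $x$; a Leibniz algebra is cyclic if it is generated by one element. A Leibniz algebra $M$ is nilpotent if $M^n=0$ for some $n$, where $M^1=M$, $M^{k+1}=[M^k,M]$. A Leibniz algebra is abelian if all its products are zero. $\dot{+}$ denotes a direct sum of vector spaces. A subalgebra $U$ of $L$ is a weak quasi-ideal of $L$ if $[U,V]+[V,U]\subseteq U+V$ for every subalgebra $V$ of $L$. The Frattini ideal $\phi(L)$ is the largest ideal of $L$ contained in the intersection of all maximal subalgebras of $L$. A Lie algebra $M$ is an almost abelian Lie algebra if $M=A'+Fy$ where $A'\neq 0$ is an abelian ideal, and $[a,y]=a=-[y,a]$ for all $a\in A'$. *)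

theory Defs
  imports
    Complex_Main
    "HOL-Library.Set_Algebras"
begin

section \<open>Leibniz algebras\<close>

text \<open>
  A Leibniz algebra \<open>L\<close> is the whole type \<open>'b\<close>, with its vector space structure given by the locale
  \<^locale>\<open>vector_space\<close>. Subalgebras and ideals are sets, and \<open>+\<close> on sets is the elementwise sum of
  \<^theory>\<open>HOL-Library.Set_Algebras\<close>.
\<close>

locale leibniz_algebra = vector_space scale
  for scale :: "'a::field \<Rightarrow> 'b::ab_group_add \<Rightarrow> 'b" +
  fixes bracket :: "'b \<Rightarrow> 'b \<Rightarrow> 'b"
  assumes linear_bracket_left: "Vector_Spaces.linear scale scale (\<lambda>x. bracket x y)"
    and linear_bracket_right: "Vector_Spaces.linear scale scale (\<lambda>y. bracket x y)"
    and leibniz: "bracket x (bracket y z) = bracket (bracket x y) z - bracket (bracket x z) y"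
begin

definition set_bracket :: "'b set \<Rightarrow> 'b set \<Rightarrow> 'b set" where
  "set_bracket U V = span {bracket u v | u v. u \<in> U \<and> v \<in> V}"

definition subalgebra :: "'b set \<Rightarrow> bool" where
  "subalgebra U \<longleftrightarrow> subspace U \<and> (\<forall>u\<in>U. \<forall>v\<in>U. bracket u v \<in> U)"

definition ideal :: "'b set \<Rightarrow> bool" where
  "ideal I \<longleftrightarrow> subspace I \<and> (\<forall>a\<in>I. \<forall>x. bracket a x \<in> I \<and> bracket x a \<in> I)"

definition abelian :: "'b set \<Rightarrow> bool" where
  "abelian U \<longleftrightarrow> (\<forall>u\<in>U. \<forall>v\<in>U. bracket u v = 0)"

definition generated :: "'b set \<Rightarrow> 'b set" where
  "generated S = subalgebra hull S"

definition cyclic :: "'b set \<Rightarrow> bool" where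
  "cyclic U \<longleftrightarrow> (\<exists>x. U = generated {x})"

text \<open>Both \<open>x\<^sup>k\<close> and \<open>M\<^sup>k\<close> are indexed from \<open>k = 1\<close>; the value at \<open>k = 0\<close> is a dummy.\<close>

definition pow :: "'b \<Rightarrow> nat \<Rightarrow> 'b" where
  "pow x k = ((\<lambda>y. bracket y x) ^^ (k - 1)) x"

definition set_pow :: "'b set \<Rightarrow> nat \<Rightarrow> 'b set" where
  "set_pow M k = ((\<lambda>N. set_bracket N M) ^^ (k - 1)) M"

definition nilpotent :: "'b set \<Rightarrow> bool" where
  "nilpotent M \<longleftrightarrow> (\<exists>n\<ge>1. set_pow M n = {0})"

definition weak_quasi_ideal :: "'b set \<Rightarrow> bool" where
  "weak_quasi_ideal U \<longleftrightarrow> subalgebra U \<and>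
     (\<forall>V. subalgebra V \<longrightarrow> set_bracket U V + set_bracket V U \<subseteq> U + V)"

definition maximal_subalgebra :: "'b set \<Rightarrow> bool" where
  "maximal_subalgebra M \<longleftrightarrow> subalgebra M \<and> M \<noteq> UNIV \<and>
     (\<forall>U. subalgebra U \<longrightarrow> M \<subseteq> U \<longrightarrow> U = M \<or> U = UNIV)"

definition frattini_ideal :: "'b set" where
  "frattini_ideal = (GREATEST I. ideal I \<and> I \<subseteq> \<Inter> {M. maximal_subalgebra M})"

end

section \<open>Lie algebras on a carrier set and quotients\<close>

text \<open>
  The elements of \<open>L/I\<close> are the cosets of \<open>I\<close>, and these do not form a type of their own. So a quotient
  is a record with an explicit carrier, and Lie algebras are defined for such records.
\<close>

record ('a, 'w) alg =
  carr :: "'w set"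
  add :: "'w \<Rightarrow> 'w \<Rightarrow> 'w"
  zer :: 'w
  smul :: "'a \<Rightarrow> 'w \<Rightarrow> 'w"
  brk :: "'w \<Rightarrow> 'w \<Rightarrow> 'w"

locale lie_algebra_on =
  fixes M :: "('a::field, 'w) alg"
  assumes add_closed: "\<lbrakk>x \<in> carr M; y \<in> carr M\<rbrakk> \<Longrightarrow> add M x y \<in> carr M"
    and zero_closed: "zer M \<in> carr M"
    and add_assoc: "\<lbrakk>x \<in> carr M; y \<in> carr M; z \<in> carr M\<rbrakk> \<Longrightarrow>
      add M (add M x y) z = add M x (add M y z)"
    and add_commute: "\<lbrakk>x \<in> carr M; y \<in> carr M\<rbrakk> \<Longrightarrow> add M x y = add M y x"
    and add_zero: "x \<in> carr M \<Longrightarrow> add M x (zer M) = x"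
    and add_inverse: "x \<in> carr M \<Longrightarrow> \<exists>y\<in>carr M. add M x y = zer M"
    and smul_closed: "x \<in> carr M \<Longrightarrow> smul M c x \<in> carr M"
    and smul_add_right: "\<lbrakk>x \<in> carr M; y \<in> carr M\<rbrakk> \<Longrightarrow>
      smul M c (add M x y) = add M (smul M c x) (smul M c y)"
    and smul_add_left: "x \<in> carr M \<Longrightarrow> smul M (c + d) x = add M (smul M c x) (smul M d x)"
    and smul_smul: "x \<in> carr M \<Longrightarrow> smul M c (smul M d x) = smul M (c * d) x"
    and smul_one: "x \<in> carr M \<Longrightarrow> smul M 1 x = x"
    and brk_closed: "\<lbrakk>x \<in> carr M; y \<in> carr M\<rbrakk> \<Longrightarrow> brk M x y \<in> carr M"
    and brk_add_left: "\<lbrakk>x \<in> carr M; y \<in> carr M; z \<in> carr M\<rbrakk> \<Longrightarrow>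
      brk M (add M x y) z = add M (brk M x z) (brk M y z)"
    and brk_add_right: "\<lbrakk>x \<in> carr M; y \<in> carr M; z \<in> carr M\<rbrakk> \<Longrightarrow>
      brk M x (add M y z) = add M (brk M x y) (brk M x z)"
    and brk_smul_left: "\<lbrakk>x \<in> carr M; y \<in> carr M\<rbrakk> \<Longrightarrow> brk M (smul M c x) y = smul M c (brk M x y)"
    and brk_smul_right: "\<lbrakk>x \<in> carr M; y \<in> carr M\<rbrakk> \<Longrightarrow> brk M x (smul M c y) = smul M c (brk M x y)"
    and brk_self: "x \<in> carr M \<Longrightarrow> brk M x x = zer M"
    and jacobi: "\<lbrakk>x \<in> carr M; y \<in> carr M; z \<in> carr M\<rbrakk> \<Longrightarrow>
      add M (add M (brk M x (brk M y z)) (brk M y (brk M z x))) (brk M z (brk M x y)) = zer M"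

definition abelian_ideal_on :: "('a::field, 'w) alg \<Rightarrow> 'w set \<Rightarrow> bool" where
  "abelian_ideal_on M A \<longleftrightarrow>
     A \<subseteq> carr M \<and> zer M \<in> A \<and> (\<forall>a\<in>A. \<forall>b\<in>A. add M a b \<in> A) \<and> (\<forall>c. \<forall>a\<in>A. smul M c a \<in> A) \<and>
     (\<forall>a\<in>A. \<forall>x\<in>carr M. brk M a x \<in> A \<and> brk M x a \<in> A) \<and>
     (\<forall>a\<in>A. \<forall>b\<in>A. brk M a b = zer M)"

definition almost_abelian_lie_algebra :: "('a::field, 'w) alg \<Rightarrow> bool" where
  "almost_abelian_lie_algebra M \<longleftrightarrow> lie_algebra_on M \<and>
     (\<exists>A. \<exists>y\<in>carr M. abelian_ideal_on M A \<and> A \<noteq> {zer M} \<and>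
        carr M = {add M a (smul M c y) | a c. a \<in> A} \<and>
        (\<forall>a\<in>A. brk M a y = a \<and> brk M y a = smul M (- 1) a))"

context leibniz_algebra
begin

text \<open>
  The operations on cosets are unions over all representatives; for an ideal \<open>I\<close> they are the usual ones,
  see the lemmas \<open>quotient_add\<close>, \<open>quotient_smul\<close> and \<open>quotient_brk\<close> below.
\<close>

definition quotient :: "'b set \<Rightarrow> ('a, 'b set) alg" where
  "quotient I =
     \<lparr>carr = range (\<lambda>x. x +o I),
      add = (\<lambda>X Y. \<Union>x\<in>X. \<Union>y\<in>Y. (x + y) +o I),
      zer = I,
      smul = (\<lambda>c X. \<Union>x\<in>X. scale c x +o I),
      brk = (\<lambda>X Y. \<Union>x\<in>X. \<Union>y\<in>Y. bracket x y +o I)\<rparr>"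

lemma coset_eq_iff:
  assumes "subspace I"
  shows "x +o I = y +o I \<longleftrightarrow> x - y \<in> I"
proof
  assume "x +o I = y +o I"
  moreover have "x \<in> x +o I"
    using subspace_0[OF assms] by (auto simp: elt_set_plus_def)
  ultimately have "x \<in> y +o I" by simp
  then show "x - y \<in> I" by (auto simp: elt_set_plus_def)
next
  assume d: "x - y \<in> I"
  have "x + i = y + ((x - y) + i)" "y + i = x + (i - (x - y))" for i by simp_all
  then show "x +o I = y +o I"
    using subspace_add[OF assms d] subspace_diff[OF assms _ d]
    unfolding elt_set_plus_def by blast
qed

lemma coset_mem: "(u :: 'b) \<in> x +o I \<Longrightarrow> u - x \<in> I"
  by (auto simp: elt_set_plus_def)

lemma coset_self: "subspace I \<Longrightarrow> x \<in> x +o I"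
  using subspace_0 by (auto simp: elt_set_plus_def)

lemma quotient_add:
  assumes "subspace I"
  shows "add (quotient I) (x +o I) (y +o I) = (x + y) +o I"
proof -
  have "(u + v) +o I = (x + y) +o I" if "u \<in> x +o I" "v \<in> y +o I" for u v
  proof -
    have "u + v - (x + y) = (u - x) + (v - y)" by simp
    also have "\<dots> \<in> I" using that assms by (intro subspace_add coset_mem)
    finally show ?thesis by (simp add: coset_eq_iff[OF assms])
  qed
  then have "(\<Union>u\<in>x +o I. \<Union>v\<in>y +o I. (u + v) +o I) = (x + y) +o I"
    using coset_self[OF assms] by (intro SUP_eq_const) blast+
  then show ?thesis by (simp add: quotient_def)
qed

lemma quotient_smul:
  assumes "subspace I"
  shows "smul (quotient I) c (x +o I) = scale c x +o I"
proof -
  have "scale c u +o I = scale c x +o I" if "u \<in> x +o I" for u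
    using subspace_scale[OF assms coset_mem[OF that], of c]
    by (simp add: coset_eq_iff[OF assms] scale_right_diff_distrib)
  then have "(\<Union>u\<in>x +o I. scale c u +o I) = scale c x +o I"
    using coset_self[OF assms] by (intro SUP_eq_const) blast+
  then show ?thesis by (simp add: quotient_def)
qed

lemma quotient_brk:
  assumes "ideal I"
  shows "brk (quotient I) (x +o I) (y +o I) = bracket x y +o I"
proof -
  have s: "subspace I" using assms by (simp add: ideal_def)
  have "bracket u v +o I = bracket x y +o I" if "u \<in> x +o I" "v \<in> y +o I" for u v
  proof -
    interpret l: Vector_Spaces.linear scale scale "\<lambda>x. bracket x v" by (rule linear_bracket_left)
    interpret r: Vector_Spaces.linear scale scale "bracket x" by (rule linear_bracket_right)
    have "bracket u v - bracket x y = bracket (u - x) v + bracket x (v - y)"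
      by (simp add: l.diff r.diff)
    also have "\<dots> \<in> I"
      using that assms coset_mem by (intro subspace_add[OF s]) (auto simp: ideal_def)
    finally show ?thesis by (simp add: coset_eq_iff[OF s])
  qed
  then have "(\<Union>u\<in>x +o I. \<Union>v\<in>y +o I. bracket u v +o I) = bracket x y +o I"
    using coset_self[OF s] by (intro SUP_eq_const) blast+
  then show ?thesis by (simp add: quotient_def)
qed

text \<open>The largest ideal in the intersection of the maximal subalgebras exists.\<close>

lemma frattini_ideal_greatest:
  shows "ideal frattini_ideal"
    and "frattini_ideal \<subseteq> \<Inter> {M. maximal_subalgebra M}"
    and "\<lbrakk>ideal J; J \<subseteq> \<Inter> {M. maximal_subalgebra M}\<rbrakk> \<Longrightarrow> J \<subseteq> frattini_ideal"
proof -
  define P where "P = (\<lambda>I. ideal I \<and> I \<subseteq> \<Inter> {M. maximal_subalgebra M})"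
  define S where "S = span (\<Union> {I. P I})"
  have sub: "subspace (\<Inter> {M. maximal_subalgebra M})"
    by (intro subspace_Inter) (auto simp: maximal_subalgebra_def subalgebra_def)
  have "bracket a x \<in> S \<and> bracket x a \<in> S" if "a \<in> S" for a x
  proof -
    interpret l: Vector_Spaces.linear scale scale "\<lambda>a. bracket a x" by (rule linear_bracket_left)
    interpret r: Vector_Spaces.linear scale scale "bracket x" by (rule linear_bracket_right)
    show ?thesis using that unfolding S_def
    proof (induction rule: span_induct)
      case base
      show ?case
        by (rule subspaceI)
          (auto simp: l.zero r.zero l.add r.add l.scale r.scale span_zero span_add span_scale)
    next
      case (step a)
      then have "bracket a x \<in> \<Union> {I. P I} \<and> bracket x a \<in> \<Union> {I. P I}"
        unfolding P_def ideal_def by blast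
      then show ?case by (simp add: span_base)
    qed
  qed
  then have "ideal S" by (simp add: ideal_def S_def)
  moreover have "S \<subseteq> \<Inter> {M. maximal_subalgebra M}"
    unfolding S_def by (rule span_minimal[OF _ sub]) (auto simp: P_def)
  ultimately have "P S" by (simp add: P_def)
  moreover have "I \<subseteq> S" if "P I" for I
    using that unfolding S_def by (blast intro: span_base)
  moreover have "frattini_ideal = Greatest P" by (simp add: frattini_ideal_def P_def)
  ultimately have *: "P frattini_ideal" "\<And>I. P I \<Longrightarrow> I \<subseteq> frattini_ideal"
    by (metis Greatest_equality)+
  show "ideal frattini_ideal" "frattini_ideal \<subseteq> \<Inter> {M. maximal_subalgebra M}"
    using *(1) by (auto simp: P_def)
  show "\<lbrakk>ideal J; J \<subseteq> \<Inter> {M. maximal_subalgebra M}\<rbrakk> \<Longrightarrow> J \<subseteq> frattini_ideal"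
    using *(2) by (simp add: P_def)
qed

end

end

theory Submission
  imports Defs
begin

text \<open>
  Let \<open>L/\<phi>(L)\<close> be spanned by its abelian ideal \<open>A'/\<phi>(L)\<close> and the image of \<open>y\<close>, and
  let \<open>R\<close> and \<open>N\<close> be right multiplication by \<open>x\<close> and by \<open>a\<close>. Right multiplication by \<open>x\<^sup>k\<close>, \<open>k \<ge> 2\<close>, is zero, so
  the Fitting null component of \<open>y\<close> under right multiplication by \<open>y\<close> may replace \<open>y\<close>, and it is some \<open>x\<close> with
  \<open>\<langle>x\<rangle>\<close> nilpotent. Likewise elements of \<open>A'\<close> may be corrected modulo \<open>\<phi>(L)\<close> so that \<open>R - 1\<close> is nilpotent on them.

  The heart of the matter is that for such an \<open>a \<notin> \<phi>(L)\<close> one has \<open>[a,x] = a\<close>, \<open>[x,a] = -a\<close> and \<open>a\<^sup>2 = 0\<close> exactly.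
  Since \<open>\<langle>x\<rangle>\<close> and \<open>\<langle>a\<rangle>\<close> are weak quasi-ideals, \<open>\<langle>x\<rangle> + \<langle>a\<rangle>\<close> is a subalgebra, and
  \<open>K = \<phi>(L) \<inter> (\<langle>x\<rangle> + \<langle>a\<rangle>)\<close> is spanned by the powers \<open>x\<^sup>k, a\<^sup>k\<close> with \<open>k \<ge> 2\<close>, which have zero right
  multiplication. Modulo \<open>J = N K\<close> the operator \<open>R\<close> has on \<open>K\<close> only the eigenvalues \<open>0\<close> (from \<open>x\<^sup>k\<close>) and \<open>2\<close> (from
  \<open>a\<^sup>2\<close>), so the errors in \<open>[a,x] = a\<close> and \<open>[x,a] = -a\<close> lie in \<open>J\<close>. Applying the hypothesis to
  \<open>u = x + a - a\<^sup>2/2\<close> and \<open>x\<close> puts \<open>a\<^sup>2\<close> into \<open>J\<close>. Now the relation \<open>R N = N (R + 1)\<close> shows that on \<open>J / N J\<close> the only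
  eigenvalue is \<open>1\<close>, while \<open>K\<close> contributes only \<open>0\<close> and \<open>2\<close>. So \<open>J = N J\<close>, and \<open>J = 0\<close> as \<open>N\<close> is nilpotent.

  Finally the elements of \<open>A'\<close> with \<open>[a,x] = a\<close>, \<open>[x,a] = -a\<close> form a subspace \<open>A\<close> with \<open>A + \<langle>x\<rangle> + \<phi>(L) = L\<close>,
  and a subalgebra that together with \<open>\<phi>(L)\<close> spans \<open>L\<close> is all of \<open>L\<close>.
\<close>

section \<open>Powers of an element and one-generated subalgebras\<close>

context leibniz_algebra
begin

section \<open>Bilinearity, sums of subspaces and subalgebras\<close>

lemma bracket_add_left: "bracket (u + v) z = bracket u z + bracket v z"
  and bracket_diff_left: "bracket (u - v) z = bracket u z - bracket v z"
  and bracket_minus_left: "bracket (- u) z = - bracket u z"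
  and bracket_scale_left: "bracket (scale c u) z = scale c (bracket u z)"
  and bracket_zero_left [simp]: "bracket 0 z = 0"
proof -
  interpret l: Vector_Spaces.linear scale scale "\<lambda>x. bracket x z" by (rule linear_bracket_left)
  show "bracket (u + v) z = bracket u z + bracket v z" "bracket (u - v) z = bracket u z - bracket v z"
    "bracket (- u) z = - bracket u z" "bracket (scale c u) z = scale c (bracket u z)" "bracket 0 z = 0"
    by (rule l.add l.diff l.neg l.scale l.zero)+
qed

lemma bracket_add_right: "bracket z (u + v) = bracket z u + bracket z v"
  and bracket_diff_right: "bracket z (u - v) = bracket z u - bracket z v"
  and bracket_minus_right: "bracket z (- u) = - bracket z u"
  and bracket_scale_right: "bracket z (scale c u) = scale c (bracket z u)"
  and bracket_zero_right [simp]: "bracket z 0 = 0"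
proof -
  interpret r: Vector_Spaces.linear scale scale "bracket z" by (rule linear_bracket_right)
  show "bracket z (u + v) = bracket z u + bracket z v" "bracket z (u - v) = bracket z u - bracket z v"
    "bracket z (- u) = - bracket z u" "bracket z (scale c u) = scale c (bracket z u)" "bracket z 0 = 0"
    by (rule r.add r.diff r.neg r.scale r.zero)+
qed

lemmas bracket_simps =
  bracket_add_left bracket_diff_left bracket_minus_left bracket_scale_left
  bracket_add_right bracket_diff_right bracket_minus_right bracket_scale_right

text \<open>This is the Leibniz identity in the form used throughout: right multiplication by
  \<open>z\<close> is a derivation.\<close>

lemma bracket_derivation: "bracket (bracket u v) z = bracket (bracket u z) v + bracket u (bracket v z)"
  using leibniz[of u v z] by simp

lemma subspace_vimage_bracket:
  assumes "subspace S"
  shows "subspace {z. bracket z x \<in> S}" and "subspace {z. bracket x z \<in> S}"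
  using assms by (auto intro!: subspaceI
      simp: bracket_simps subspace_0 subspace_add subspace_scale)

lemma subspace_set_plus: "subspace S \<Longrightarrow> subspace T \<Longrightarrow> subspace (S + T)"
proof -
  assume "subspace S" "subspace T"
  moreover have "S + T = {x + y |x y. x \<in> S \<and> y \<in> T}"
    by (auto simp: set_plus_def)
  ultimately show ?thesis by (simp add: subspace_sums)
qed

lemma subset_set_plus_left: "subspace T \<Longrightarrow> S \<subseteq> S + T"
  and subset_set_plus_right: "subspace T \<Longrightarrow> S \<subseteq> T + S"
  using set_zero_plus2 subspace_0 by (metis add.commute)+

lemma set_plus_subset_subspace: "subspace U \<Longrightarrow> S \<subseteq> U \<Longrightarrow> T \<subseteq> U \<Longrightarrow> S + T \<subseteq> U"
  by (auto simp: set_plus_def intro: subspace_add)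

lemma subspace_if_subalgebra: "subalgebra U \<Longrightarrow> subspace U"
  by (simp add: subalgebra_def)

lemma subalgebra_bracket: "subalgebra U \<Longrightarrow> u \<in> U \<Longrightarrow> v \<in> U \<Longrightarrow> bracket u v \<in> U"
  by (simp add: subalgebra_def)

lemma subspace_if_ideal: "ideal I \<Longrightarrow> subspace I"
  by (simp add: ideal_def)

lemma ideal_bracket: "ideal I \<Longrightarrow> a \<in> I \<Longrightarrow> bracket a z \<in> I"
  "ideal I \<Longrightarrow> a \<in> I \<Longrightarrow> bracket z a \<in> I"
  by (simp_all add: ideal_def)

lemma subalgebra_add_ideal:
  assumes S: "subalgebra S" and I: "ideal I"
  shows "subalgebra (S + I)"
proof -
  have "bracket (s + i) (t + j) \<in> S + I" if "s \<in> S" "i \<in> I" "t \<in> S" "j \<in> I" for s i t j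
  proof -
    have "bracket s j + (bracket i t + bracket i j) \<in> I"
      using that I by (intro subspace_add subspace_if_ideal) (auto intro: ideal_bracket)
    moreover have "bracket (s + i) (t + j) = bracket s t + (bracket s j + (bracket i t + bracket i j))"
      by (simp add: bracket_simps)
    ultimately show ?thesis
      using that S by (auto intro!: set_plus_intro subalgebra_bracket)
  qed
  moreover have "subspace (S + I)"
    using assms by (intro subspace_set_plus subspace_if_ideal subspace_if_subalgebra)
  ultimately show ?thesis
    unfolding subalgebra_def by (blast elim!: set_plus_elim)
qed

text \<open>As \<open>U + V\<close> is a subspace, the spans in \<open>set_bracket\<close> may be
  replaced by single products.\<close>

lemma weak_quasi_ideal_iff:
  "weak_quasi_ideal U \<longleftrightarrow> subalgebra U \<and>
     (\<forall>V. subalgebra V \<longrightarrow> (\<forall>u\<in>U. \<forall>v\<in>V. bracket u v \<in> U + V \<and> bracket v u \<in> U + V))"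
  (is "_ \<longleftrightarrow> _ \<and> ?R")
proof (intro iffI conjI)
  assume U: "weak_quasi_ideal U"
  then show "subalgebra U" by (simp add: weak_quasi_ideal_def)
  show ?R
  proof (intro allI impI ballI)
    fix V u v assume V: "subalgebra V" and uv: "u \<in> U" "v \<in> V"
    have "bracket u v \<in> set_bracket U V" "bracket v u \<in> set_bracket V U"
      using uv by (auto simp: set_bracket_def intro!: span_base)
    moreover have "0 \<in> set_bracket U V" "0 \<in> set_bracket V U"
      by (auto simp: set_bracket_def span_zero)
    moreover have "set_bracket U V + set_bracket V U \<subseteq> U + V"
      using U V by (simp add: weak_quasi_ideal_def)
    ultimately show "bracket u v \<in> U + V \<and> bracket v u \<in> U + V"
      by (metis add.right_neutral add.left_neutral set_plus_intro subsetD)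
  qed
next
  assume U: "subalgebra U \<and> ?R"
  have "set_bracket U V + set_bracket V U \<subseteq> U + V" if V: "subalgebra V" for V
  proof -
    have s: "subspace (U + V)"
      using U V by (intro subspace_set_plus subspace_if_subalgebra) auto
    show ?thesis
      using U V unfolding set_bracket_def
      by (intro set_plus_subset_subspace[OF s] span_minimal[OF _ s]) auto
  qed
  then show "weak_quasi_ideal U"
    using U by (simp add: weak_quasi_ideal_def)
qed

section \<open>Powers of an element and the filtration they span\<close>

lemma pow_1 [simp]: "pow x (Suc 0) = x"
  by (simp add: pow_def)

lemma pow_Suc: "k \<ge> 1 \<Longrightarrow> pow x (Suc k) = bracket (pow x k) x"
  by (cases k) (simp_all add: pow_def)

lemma pow_2: "pow x 2 = bracket x x"
  using pow_Suc[of 1 x] by (simp add: numeral_2_eq_2)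

text \<open>For \<open>k = 2\<close> the two terms of the Leibniz identity cancel. For
  \<open>pow x (Suc k)\<close> each of them has \<open>pow x k\<close> as a right factor, hence the
  induction for arbitrary \<open>z\<close>.\<close>

lemma bracket_pow_right:
  assumes "k \<ge> 2" shows "bracket z (pow x k) = 0"
  using assms
proof (induction k arbitrary: z rule: dec_induct)
  case base
  show ?case by (simp add: pow_2 leibniz)
next
  case (step k)
  then show ?case by (simp add: pow_Suc leibniz)
qed

text \<open>\<open>tail x 1\<close> is the subalgebra generated by \<open>x\<close>, and
  \<open>tail x k\<close> is its \<open>k\<close>-th power; \<open>tail x 2\<close> annihilates
  everything from the right.\<close>

definition tail :: "'b \<Rightarrow> nat \<Rightarrow> 'b set" where
  "tail x k = span (pow x ` {k..})"

lemma subspace_tail [simp]: "subspace (tail x k)"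
  by (simp add: tail_def)

lemma pow_in_tail: "k \<le> j \<Longrightarrow> pow x j \<in> tail x k"
  by (auto simp: tail_def intro: span_base)

lemma tail_mono: "k \<le> j \<Longrightarrow> tail x j \<subseteq> tail x k"
  unfolding tail_def by (intro span_mono) auto

lemma tail_subset:
  assumes "subspace S" "\<And>j. j \<ge> k \<Longrightarrow> pow x j \<in> S"
  shows "tail x k \<subseteq> S"
  unfolding tail_def using assms by (intro span_minimal) auto

text \<open>Splits off the coefficient of the lowest power.\<close>

lemma tail_Suc_iff: "z \<in> tail x k \<longleftrightarrow> (\<exists>c. z - scale c (pow x k) \<in> tail x (Suc k))"
proof -
  have "{k..} = insert k {Suc k..}" by auto
  then show ?thesis by (simp add: tail_def span_insert)
qed

lemma bracket_tail_right:
  assumes "w \<in> tail x 2" shows "bracket z w = 0"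
proof -
  have "tail x 2 \<subseteq> {w. bracket z w \<in> {0}}"
    by (intro tail_subset subspace_vimage_bracket) (auto simp: bracket_pow_right)
  then show ?thesis using assms by auto
qed

lemma bracket_tail:
  assumes "k \<ge> 1" "z \<in> tail x k" shows "bracket z x \<in> tail x (Suc k)"
proof -
  have "tail x k \<subseteq> {z. bracket z x \<in> tail x (Suc k)}"
    using assms(1)
    by (intro tail_subset subspace_vimage_bracket) (auto simp flip: pow_Suc intro: pow_in_tail)
  then show ?thesis using assms by auto
qed

lemma tail_eq_0:
  assumes "pow x n = 0" "1 \<le> n" "n \<le> k"
  shows "tail x k = {0}"
proof -
  have "pow x j = 0" if "n \<le> j" for j
    using that by (induction j rule: dec_induct) (use assms in \<open>auto simp: pow_Suc\<close>)
  then have "tail x k \<subseteq> {0}"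
    using assms by (intro tail_subset) auto
  then show ?thesis using subspace_0[of "tail x k"] by auto
qed

lemma self_in_tail: "x \<in> tail x 1"
  using pow_in_tail[of 1 1 x] by simp

lemma tail_1E:
  assumes "z \<in> tail x 1"
  obtains c w where "w \<in> tail x 2" "z = scale c x + w"
proof -
  obtain c where "z - scale c x \<in> tail x 2"
    using assms by (auto simp: tail_Suc_iff[of z x "Suc 0"] numeral_2_eq_2)
  then show ?thesis by (intro that[of "z - scale c x" c]) simp_all
qed

text \<open>Only the \<open>x\<close>-component of the right factor acts, so closure under right
  multiplication by \<open>x\<close> is enough.\<close>

lemma subalgebra_tail: "k \<ge> 1 \<Longrightarrow> subalgebra (tail x k)"
proof -
  assume k: "k \<ge> 1"
  have "bracket u v \<in> tail x k" if u: "u \<in> tail x k" and v: "v \<in> tail x k" for u v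
  proof -
    have "v \<in> tail x 1" using v tail_mono[OF k] by auto
    then obtain c w where w: "w \<in> tail x 2" "v = scale c x + w"
      by (rule tail_1E)
    have "bracket u x \<in> tail x k"
      using bracket_tail[OF k u] tail_mono[of k "Suc k" x] by auto
    then show ?thesis
      using w by (simp add: bracket_simps bracket_tail_right subspace_scale)
  qed
  then show ?thesis by (simp add: subalgebra_def)
qed

lemma generated_singleton: "generated {x} = tail x 1"
  unfolding generated_def
proof (rule hull_unique)
  show "{x} \<subseteq> tail x 1" using pow_in_tail[of 1 1 x] by simp
  show "subalgebra (tail x 1)" by (rule subalgebra_tail) simp
  fix U assume U: "{x} \<subseteq> U" "subalgebra U"
  have "pow x j \<in> U" if "j \<ge> 1" for j
    using that by (induction j rule: dec_induct) (use U in \<open>auto simp: pow_Suc subalgebra_bracket\<close>)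
  then show "tail x 1 \<subseteq> U"
    using U by (intro tail_subset subspace_if_subalgebra)
qed

section \<open>Nilpotency of cyclic algebras\<close>

lemma set_bracket_tail:
  assumes "k \<ge> 1"
  shows "set_bracket (tail x k) (tail x 1) \<subseteq> tail x (Suc k)"
proof -
  have "bracket u v \<in> tail x (Suc k)" if u: "u \<in> tail x k" and v: "v \<in> tail x 1" for u v
    using v
  proof (rule tail_1E)
    fix c w assume "w \<in> tail x 2" "v = scale c x + w"
    then show ?thesis
      using bracket_tail[OF assms u] by (simp add: bracket_simps bracket_tail_right subspace_scale)
  qed
  then show ?thesis
    unfolding set_bracket_def by (intro span_minimal) auto
qed

lemma set_pow_Suc: "k \<ge> 1 \<Longrightarrow> set_pow M (Suc k) = set_bracket (set_pow M k) M"
  by (cases k) (simp_all add: set_pow_def)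

lemma set_bracket_mono: "U \<subseteq> U' \<Longrightarrow> set_bracket U V \<subseteq> set_bracket U' V"
  unfolding set_bracket_def by (intro span_mono) auto

text \<open>The upper bound \<open>tail x k\<close> yields nilpotency from a vanishing power of
  \<open>x\<close>; membership of \<open>pow x k\<close> yields the converse.\<close>

lemma set_pow_generated:
  assumes "k \<ge> 1"
  shows "set_pow (generated {x}) k \<subseteq> tail x k" "pow x k \<in> set_pow (generated {x}) k"
    "0 \<in> set_pow (generated {x}) k"
proof -
  have "set_pow (tail x 1) k \<subseteq> tail x k \<and> pow x k \<in> set_pow (tail x 1) k \<and> 0 \<in> set_pow (tail x 1) k"
    using assms
  proof (induction k rule: dec_induct)
    case base
    show ?case using self_in_tail[of x] by (simp add: set_pow_def subspace_0)
  next
    case (step k)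
    have "set_pow (tail x 1) (Suc k) \<subseteq> tail x (Suc k)"
      using step set_bracket_mono[of "set_pow (tail x 1) k" "tail x k"] set_bracket_tail[of k x]
      by (auto simp: set_pow_Suc)
    moreover have "pow x (Suc k) \<in> set_pow (tail x 1) (Suc k)"
      using step self_in_tail[of x]
      by (auto simp: set_pow_Suc set_bracket_def pow_Suc intro!: span_base)
    moreover have "0 \<in> set_pow (tail x 1) (Suc k)"
      using step by (simp add: set_pow_Suc set_bracket_def span_zero)
    ultimately show ?case by blast
  qed
  then show "set_pow (generated {x}) k \<subseteq> tail x k" "pow x k \<in> set_pow (generated {x}) k"
    "0 \<in> set_pow (generated {x}) k"
    by (simp_all add: generated_singleton)
qed

lemma nilpotent_generated_iff: "nilpotent (generated {x}) \<longleftrightarrow> (\<exists>n\<ge>1. pow x n = 0)"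
  using set_pow_generated[of _ x] tail_eq_0[of x] unfolding nilpotent_def
  by (metis order_refl singletonD subset_antisym empty_subsetI insert_subset)

end

section \<open>Split extensions by a nilpotent cyclic algebra\<close>

context leibniz_algebra
begin

text \<open>Right multiplication by \<open>x\<close> shifts leading terms, so \<open>M\<close>
  contains an element with leading term \<open>scale c (pow x k)\<close> for each
  \<open>k \<ge> 2\<close>. Triangular elimination, starting from a vanishing tail and going down in
  \<open>k\<close>, then gives all powers.\<close>

lemma tail_subset_if_leading:
  assumes M: "subspace M" and c: "c \<noteq> 0"
    and z: "z \<in> M" "z - scale c (pow x 2) \<in> tail x 3"
    and closed: "\<And>v. v \<in> M \<Longrightarrow> v \<in> tail x 2 \<Longrightarrow> bracket v x \<in> M"
    and nil: "pow x n = 0" "n \<ge> 1"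
  shows "tail x 2 \<subseteq> M"
proof -
  have leading: "\<exists>z\<in>M. z - scale c (pow x k) \<in> tail x (Suc k)" if "2 \<le> k" for k
    using that
  proof (induction k rule: dec_induct)
    case base
    then show ?case using z by (auto simp: numeral_3_eq_3 numeral_2_eq_2)
  next
    case (step k)
    then obtain z where z: "z \<in> M" "z - scale c (pow x k) \<in> tail x (Suc k)" by blast
    have "(z - scale c (pow x k)) + scale c (pow x k) \<in> tail x k"
      using z(2) tail_mono[of k "Suc k" x] by (intro subspace_add subspace_scale) (auto intro: pow_in_tail)
    then have "z \<in> tail x 2" using step(1) tail_mono[of 2 k x] by auto
    then have "bracket z x \<in> M" using closed z by blast
    moreover have "bracket z x - scale c (pow x (Suc k)) \<in> tail x (Suc (Suc k))"
      using bracket_tail[OF _ z(2)] step(1) by (simp add: bracket_simps pow_Suc)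
    ultimately show ?case by blast
  qed
  \<comment> \<open>The maximum covers \<open>n = 1\<close>, since the descent has to start at an
    index of at least 2.\<close>
  define m where "m = max n 2"
  have "2 \<le> m" by (simp add: m_def)
  then show ?thesis
  proof (induction rule: inc_induct)
    case base
    have "tail x m = {0}" using nil by (intro tail_eq_0[of x n]) (auto simp: m_def)
    then show ?case using M by (simp add: subspace_0)
  next
    case (step k)
    obtain z where z: "z \<in> M" "z - scale c (pow x k) \<in> tail x (Suc k)"
      using leading step(1) by blast
    then have "z - scale c (pow x k) \<in> M" using step(3) by auto
    then have "z - (z - scale c (pow x k)) \<in> M" by (rule subspace_diff[OF M z(1)])
    then have "scale c (pow x k) \<in> M" by simp
    then have "scale (1 / c) (scale c (pow x k)) \<in> M" by (rule subspace_scale[OF M])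
    then have pk: "pow x k \<in> M" using c by simp
    have "v \<in> M" if v: "v \<in> tail x k" for v
    proof -
      obtain d where "v - scale d (pow x k) \<in> M"
        using v step(3) by (auto simp: tail_Suc_iff[of v])
      then have "(v - scale d (pow x k)) + scale d (pow x k) \<in> M"
        using M pk by (intro subspace_add subspace_scale) auto
      then show ?thesis by simp
    qed
    then show ?case by blast
  qed
qed

section \<open>Quotients that are Lie algebras\<close>

lemma carr_quotient: "carr (quotient I) = range (\<lambda>x. x +o I)"
  and zer_quotient: "zer (quotient I) = 0 +o I"
  by (simp_all add: quotient_def)

text \<open>Polarising the squares gives antisymmetry modulo \<open>I\<close>, which turns the
  Leibniz identity into the Jacobi identity.\<close>

lemma lie_algebra_on_quotient:
  assumes I: "ideal I" and sq: "\<And>v. bracket v v \<in> I"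
  shows "lie_algebra_on (quotient I)"
proof -
  have s: "subspace I" using I by (rule subspace_if_ideal)
  have swap: "bracket u v + bracket v u \<in> I" for u v
  proof -
    have "bracket (u + v) (u + v) - bracket u u - bracket v v \<in> I"
      using sq s by (intro subspace_diff)
    then show ?thesis by (simp add: bracket_simps algebra_simps)
  qed
  have jacobi: "bracket u (bracket v w) + bracket v (bracket w u) + bracket w (bracket u v) \<in> I" for u v w
  proof -
    have "(bracket (bracket u v) w + bracket w (bracket u v))
        - (bracket (bracket u w) v + bracket v (bracket u w))
        + bracket v (bracket u w + bracket w u) \<in> I"
      by (intro subspace_add[OF s] subspace_diff[OF s] ideal_bracket(2)[OF I] swap)
    then show ?thesis by (simp add: leibniz[of u v w] bracket_simps algebra_simps)
  qed
  \<comment> \<open>The zero is kept as the coset \<open>0 +o I\<close> so that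
    \<open>coset_eq_iff\<close> applies; the simp rule \<open>set_zero_plus\<close> would undo
    this.\<close>
  note q = quotient_add[OF s] quotient_smul[OF s] quotient_brk[OF I] zer_quotient coset_eq_iff[OF s]
  have inv: "\<exists>y\<in>carr (quotient I). add (quotient I) x y = zer (quotient I)" if x: "x \<in> carr (quotient I)" for x
  proof -
    obtain v where "x = v +o I" using x by (auto simp: carr_quotient)
    then have "add (quotient I) x (- v +o I) = zer (quotient I)"
      by (simp add: quotient_add[OF s] zer_quotient)
    then show ?thesis by (auto simp: carr_quotient)
  qed
  show ?thesis
    by unfold_locales
      (use inv in \<open>auto simp: carr_quotient q sq jacobi bracket_simps scale_right_distrib
          scale_left_distrib add.assoc[symmetric] subspace_0[OF s] simp del: set_zero_plus intro!: rangeI del: equalityI\<close>)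
qed

lemma set_plus_tail_1E:
  assumes "v \<in> H + tail x 1"
  obtains a c w where "a \<in> H" "w \<in> tail x 2" "v = a + scale c x + w"
proof -
  obtain a t where at: "a \<in> H" "t \<in> tail x 1" "v = a + t"
    using assms by (rule set_plus_elim)
  obtain w c where "w \<in> tail x 2" "t = scale c x + w" using at(2) by (rule tail_1E)
  with at show ?thesis by (intro that[of a w c]) (simp_all add: add.assoc)
qed

end

text \<open>The part of the decomposition that is available before \<open>A\<close> and the powers
  of \<open>x\<close> are known to span the algebra.\<close>

locale weight_one_subspace = leibniz_algebra scale bracket
  for scale :: "'a::field \<Rightarrow> 'b::ab_group_add \<Rightarrow> 'b" and bracket +
  fixes A :: "'b set" and x :: 'b
  assumes subspace_A: "subspace A" and abelian_A: "abelian A"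
    and A_x: "a \<in> A \<Longrightarrow> bracket a x = a" and x_A: "a \<in> A \<Longrightarrow> bracket x a = - a"
begin

text \<open>In \<open>bracket (bracket x x) a\<close> the derivation rule produces
  \<open>- a\<close> and \<open>a\<close>, which cancel; for higher powers both of its terms vanish
  by induction.\<close>

lemma pow_A:
  assumes "a \<in> A" "k \<ge> 2" shows "bracket (pow x k) a = 0"
  using assms(2)
proof (induction k rule: dec_induct)
  case base
  then show ?case using assms(1) by (simp add: pow_2 bracket_derivation A_x x_A bracket_simps)
next
  case (step k)
  then show ?case using assms(1) by (simp add: pow_Suc bracket_derivation A_x x_A bracket_simps)
qed

lemma tail_A: 
  assumes "w \<in> tail x 2" "a \<in> A" shows "bracket w a = 0"
proof -
  have "tail x 2 \<subseteq> {w. bracket w a \<in> {0}}"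
    using assms(2) by (intro tail_subset subspace_vimage_bracket) (auto simp: pow_A)
  then show ?thesis using assms by auto
qed

text \<open>Elements of \<open>tail x 2\<close> vanish as right factors and annihilate
  \<open>A\<close>, so the right factor acts on \<open>tail x 1\<close> through \<open>d\<close>
  alone.\<close>

lemma bracket_decomposition:
  assumes "a \<in> A" "b \<in> A" "w \<in> tail x 2" "t \<in> tail x 2"
  shows "bracket (a + scale c x + w) (b + scale d x + t) =
    scale d a - scale c b + scale d (bracket (scale c x + w) x)"
  using assms abelian_A
  by (simp add: abelian_def bracket_simps bracket_tail_right tail_A A_x x_A scale_right_distrib algebra_simps)

lemma tail_2: "w \<in> tail x 2 \<Longrightarrow> bracket w x \<in> tail x 2"
  using bracket_tail[of 2 w x] tail_mono[of 2 3 x] by (auto simp: numeral_3_eq_3 numeral_2_eq_2)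

lemma bracket_in_tail_2: "w \<in> tail x 2 \<Longrightarrow> bracket (scale c x + w) x \<in> tail x 2"
  using pow_in_tail[of 2 2 x]
  by (auto simp: bracket_simps pow_2 intro!: subspace_add subspace_scale tail_2)

text \<open>With \<open>H\<close> a hyperplane of \<open>A\<close>, or with \<open>H = A\<close>,
  these are the proper subalgebras that bound the Frattini ideal from above.\<close>

lemma subalgebra_subspace_A:
  assumes H: "subspace H" "H \<subseteq> A"
  shows "subalgebra (H + tail x 1)" "subalgebra (H + tail x 2)"
proof -
  have *: "bracket (a + scale c x + w) (b + scale d x + t) \<in> H + tail x 2"
    if "a \<in> H" "b \<in> H" "w \<in> tail x 2" "t \<in> tail x 2" for a b c d w t
  proof -
    have "bracket (a + scale c x + w) (b + scale d x + t) =
      (scale d a - scale c b) + scale d (bracket (scale c x + w) x)"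
      using that H by (subst bracket_decomposition) auto
    also have "\<dots> \<in> H + tail x 2"
      using that H by (intro set_plus_intro subspace_diff subspace_scale subspace_tail bracket_in_tail_2)
    finally show ?thesis .
  qed
  have "bracket u v \<in> H + tail x 2" if u: "u \<in> H + tail x 1" and v: "v \<in> H + tail x 1" for u v
  proof -
    obtain a c w where "a \<in> H" "w \<in> tail x 2" "u = a + scale c x + w"
      using u by (rule set_plus_tail_1E)
    moreover obtain b d t where "b \<in> H" "t \<in> tail x 2" "v = b + scale d x + t"
      using v by (rule set_plus_tail_1E)
    ultimately show ?thesis using * by simp
  qed
  moreover have "H + tail x 2 \<subseteq> H + tail x 1"
    using tail_mono[of 1 2 x] by (intro set_plus_mono2) auto
  moreover have "subspace (H + tail x 1)" "subspace (H + tail x 2)"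
    using H by (auto intro: subspace_set_plus)
  ultimately show "subalgebra (H + tail x 1)" "subalgebra (H + tail x 2)"
    unfolding subalgebra_def by blast+
qed

end

text \<open>The decomposition on the right of the theorem, with nilpotency of the cyclic algebra
  expressed by a vanishing power of \<open>x\<close>.\<close>

locale almost_abelian_extension = weight_one_subspace +
  fixes n :: nat
  assumes A_nonzero: "A \<noteq> {0}" and A_sum: "A + tail x 1 = UNIV" and A_inter: "A \<inter> tail x 1 = {0}"
    and pow_n: "pow x n = 0" and n_pos: "1 \<le> n"
begin

section \<open>Subalgebras, Frattini ideal and quotient of a split extension\<close>

lemma decomposition:
  obtains a c w where "a \<in> A" "w \<in> tail x 2" "v = a + scale c x + w"
proof -
  have "v \<in> A + tail x 1" using A_sum by simp
  then show ?thesis using that by (rule set_plus_tail_1E)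
qed

lemma ideal_A: "ideal A"
proof -
  have "bracket a v \<in> A" "bracket v a \<in> A" if a: "a \<in> A" for a v
  proof -
    obtain b c w where 1: "b \<in> A" "w \<in> tail x 2" "v = b + scale c x + w"
      by (rule decomposition)
    have "bracket a v = scale c a" "bracket v a = scale (- c) a"
      using bracket_decomposition[OF a 1(1) subspace_0[OF subspace_tail] 1(2), of 0 c]
        bracket_decomposition[OF 1(1) a 1(2) subspace_0[OF subspace_tail], of c 0]
      by (simp_all add: 1(3))
    then show "bracket a v \<in> A" "bracket v a \<in> A" by (simp_all only: subspace_scale[OF subspace_A a])
  qed
  then show ?thesis using subspace_A by (simp add: ideal_def)
qed

lemma ideal_tail: "ideal (tail x 2)"
proof -
  have "bracket w v \<in> tail x 2" if w: "w \<in> tail x 2" for w v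
  proof -
    obtain a c t where "a \<in> A" "t \<in> tail x 2" "v = a + scale c x + t"
      by (rule decomposition)
    then show ?thesis
      using w by (simp add: bracket_simps bracket_tail_right tail_A tail_2 subspace_scale)
  qed
  then show ?thesis
    by (simp add: ideal_def bracket_tail_right subspace_0)
qed

text \<open>The square of the given element has leading term \<open>scale (c * c) (pow x 2)\<close>,
  and on \<open>tail x 2\<close> right multiplication by that element is \<open>c\<close> times
  right multiplication by \<open>x\<close>. So \<open>tail_subset_if_leading\<close>
  applies.\<close>

lemma tail_subset_subalgebra:
  assumes V: "subalgebra V" and v: "a + scale c x + w \<in> V" and "a \<in> A" "w \<in> tail x 2" and c: "c \<noteq> 0"
  shows "tail x 2 \<subseteq> V"
proof (rule tail_subset_if_leading[OF subspace_if_subalgebra[OF V] _ subalgebra_bracket[OF V v v] _ _ pow_n n_pos])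
  show "c * c \<noteq> 0" using c by simp
  have "bracket (a + scale c x + w) (a + scale c x + w) - scale (c * c) (pow x 2) = scale c (bracket w x)"
    using assms by (subst bracket_decomposition) (simp_all add: pow_2 bracket_simps scale_right_distrib)
  also have "\<dots> \<in> tail x 3"
    using assms bracket_tail[of 2 w x] by (simp add: subspace_scale numeral_3_eq_3 numeral_2_eq_2)
  finally show "bracket (a + scale c x + w) (a + scale c x + w) - scale (c * c) (pow x 2) \<in> tail x 3" .
  fix z assume z: "z \<in> V" "z \<in> tail x 2"
  have "scale (1 / c) (bracket z (a + scale c x + w)) \<in> V"
    using z V v by (intro subspace_scale subspace_if_subalgebra subalgebra_bracket)
  then show "bracket z x \<in> V"
    using z assms by (simp add: bracket_simps tail_A bracket_tail_right)
qed

text \<open>Up to \<open>tail x 2\<close>, the product of \<open>u\<close> and \<open>v\<close> is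
  \<open>scale d u - scale c v\<close>. If \<open>c\<close> or \<open>d\<close> is nonzero,
  \<open>U\<close> or \<open>V\<close> contains \<open>tail x 2\<close>; otherwise the product is
  zero.\<close>

lemma weak_quasi_ideal_if_subalgebra:
  assumes U: "subalgebra U" shows "weak_quasi_ideal U"
proof -
  have "bracket u v \<in> U + V" if U: "subalgebra U" and V: "subalgebra V" and u: "u \<in> U" and v: "v \<in> V" for U V u v
  proof -
    obtain a c w where 1: "a \<in> A" "w \<in> tail x 2" "u = a + scale c x + w" by (rule decomposition)
    obtain b d t where 2: "b \<in> A" "t \<in> tail x 2" "v = b + scale d x + t" by (rule decomposition)
    have s: "subspace (U + V)" using U V by (intro subspace_set_plus subspace_if_subalgebra)
    have sub: "U \<subseteq> U + V" "V \<subseteq> U + V"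
      using U V by (auto intro!: subset_set_plus_left subset_set_plus_right subspace_if_subalgebra)
    show ?thesis
    proof (cases "c = 0 \<and> d = 0")
      case True
      then show ?thesis using s 1 2 bracket_decomposition[of a b w t c d] by (simp add: subspace_0)
    next
      case False
      then have tail: "tail x 2 \<subseteq> U + V"
        using tail_subset_subalgebra[OF U u[unfolded 1] 1(1,2)]
          tail_subset_subalgebra[OF V v[unfolded 2] 2(1,2)] sub by auto
      have "scale d (bracket (scale c x + w) x) - scale d w + scale c t \<in> tail x 2"
        using 1 2 by (intro subspace_add subspace_diff subspace_scale subspace_tail bracket_in_tail_2)
      moreover have "scale d u - scale c v \<in> U + V"
        using u v sub by (intro subspace_diff[OF s] subspace_scale[OF s]) auto
      ultimately have "(scale d u - scale c v) + (scale d (bracket (scale c x + w) x) - scale d w + scale c t) \<in> U + V"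
        using tail subspace_add[OF s, of "scale d u - scale c v"] by blast
      also have "(scale d u - scale c v) + (scale d (bracket (scale c x + w) x) - scale d w + scale c t) = bracket u v"
        using 1 2 bracket_decomposition[of a b w t c d]
        by (simp add: scale_right_distrib algebra_simps)
      finally show ?thesis .
    qed
  qed
  then show ?thesis
    using U by (simp add: weak_quasi_ideal_iff) (metis add.commute)
qed

text \<open>Otherwise \<open>x\<close> would lie in \<open>tail x 2\<close>, so right multiplication
  by \<open>x\<close> would be zero, but it is the identity on \<open>A\<close>.\<close>

lemma x_notin: "x \<notin> A + tail x 2"
proof
  assume "x \<in> A + tail x 2"
  then obtain a w where aw: "a \<in> A" "w \<in> tail x 2" "x = a + w" by (auto elim: set_plus_elim)
  have "a = x - w" using aw by simp
  moreover have "x - w \<in> tail x 1"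
    using aw tail_mono[of 1 2 x] self_in_tail[of x] by (intro subspace_diff) auto
  ultimately have "a = 0" using aw A_inter by auto
  then have "x \<in> tail x 2" using aw by simp
  then have "A \<subseteq> {0}" using A_x bracket_tail_right by force
  then show False using A_nonzero subspace_0[OF subspace_A] by auto
qed

text \<open>A maximal subalgebra \<open>M\<close> not absorbing \<open>tail x 2\<close> would
  supplement it, hence contain some \<open>x - t\<close> and, by
  \<open>tail_subset_subalgebra\<close>, the whole of \<open>tail x 2\<close>.\<close>

lemma tail_subset_frattini: "tail x 2 \<subseteq> frattini_ideal"
proof (rule frattini_ideal_greatest(3)[OF ideal_tail], rule Inter_greatest, clarify)
  fix M w assume M: "maximal_subalgebra M" and w: "w \<in> tail x 2"
  have sM: "subalgebra M" using M by (simp add: maximal_subalgebra_def)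
  have sub: "M \<subseteq> M + tail x 2" "tail x 2 \<subseteq> M + tail x 2"
    using subset_set_plus_left[OF subspace_tail] subset_set_plus_right[OF subspace_if_subalgebra[OF sM]] by auto
  have "M + tail x 2 = M \<or> M + tail x 2 = UNIV"
    using M sub subalgebra_add_ideal[OF sM ideal_tail] by (simp add: maximal_subalgebra_def)
  then show "w \<in> M"
  proof
    assume "M + tail x 2 = M" then show ?thesis using w sub by auto
  next
    assume "M + tail x 2 = UNIV"
    then have "x \<in> M + tail x 2" by simp
    then obtain m t where mt: "m \<in> M" "t \<in> tail x 2" "x = m + t" by (auto elim: set_plus_elim)
    then have "0 + scale 1 x + (- t) \<in> M" by simp
    then have "tail x 2 \<subseteq> M"
      using subspace_neg[OF subspace_tail mt(2)]
      by (rule tail_subset_subalgebra[OF sM _ subspace_0[OF subspace_A]]) simp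
    then show ?thesis using w by auto
  qed
qed

text \<open>A member of the Frattini ideal outside \<open>tail x 2\<close> would admit a proper
  supplement, against \<open>nongen\<close>: \<open>A + tail x 2\<close> if
  \<open>c \<noteq> 0\<close>, and \<open>H + tail x 1\<close> with \<open>H\<close> a complement of
  \<open>a\<close> in \<open>A\<close> if \<open>a \<noteq> 0\<close>.\<close>

lemma frattini_ideal_eq:
  assumes nongen: "\<And>S. subalgebra S \<Longrightarrow> S + frattini_ideal = UNIV \<Longrightarrow> S = UNIV"
  shows "frattini_ideal = tail x 2"
proof (intro subset_antisym tail_subset_frattini subsetI)
  let ?F = frattini_ideal
  have F: "subspace ?F" using frattini_ideal_greatest(1) by (rule subspace_if_ideal)
  fix v assume v: "v \<in> ?F"
  obtain a c w where 1: "a \<in> A" "w \<in> tail x 2" "v = a + scale c x + w" by (rule decomposition)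
  have "c = 0"
  proof (rule ccontr)
    assume c: "c \<noteq> 0"
    have "u \<in> A + tail x 2 + ?F" for u
    proof -
      obtain b d t where 2: "b \<in> A" "t \<in> tail x 2" "u = b + scale d x + t" by (rule decomposition)
      \<comment> \<open>As \<open>c \<noteq> 0\<close>, a multiple of \<open>v\<close> supplies the
        \<open>x\<close>-component of \<open>u\<close>.\<close>
      have u: "u = ((b - scale (d / c) a) + (t - scale (d / c) w)) + scale (d / c) v"
        using 1 2 c by (simp add: scale_right_distrib algebra_simps)
      have "b - scale (d / c) a \<in> A"
        using 1 2 subspace_A by (intro subspace_diff subspace_scale)
      moreover have "t - scale (d / c) w \<in> tail x 2"
        using 1 2 by (intro subspace_diff subspace_scale subspace_tail)
      moreover have "scale (d / c) v \<in> ?F" using v F by (intro subspace_scale)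
      ultimately show ?thesis by (subst u) (intro set_plus_intro)
    qed
    then have "A + tail x 2 = UNIV"
      using subspace_A by (intro nongen[OF subalgebra_subspace_A(2)] UNIV_eq_I) auto
    then show False using x_notin by simp
  qed
  moreover have "a = 0"
  proof (rule ccontr)
    assume a: "a \<noteq> 0"
    have "v - w \<in> ?F"
      using v 1 tail_subset_frattini by (intro subspace_diff[OF F]) auto
    then have aF: "a \<in> ?F" using 1 \<open>c = 0\<close> by simp
    obtain C where C: "{a} \<subseteq> C" "C \<subseteq> A" "independent C" "A \<subseteq> span C"
      using maximal_independent_subset_extend[of "{a}" A] 1 a by auto
    define H where "H = span (C - {a})"
    have H: "subspace H" "H \<subseteq> A"
      using C subspace_A span_minimal[of "C - {a}" A] by (auto simp: H_def)
    have aH: "a \<notin> H" using C unfolding H_def dependent_def by auto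
    have "u \<in> H + tail x 1 + ?F" for u
    proof -
      have "u \<in> A + tail x 1" using A_sum by simp
      then obtain b t where bt: "b \<in> A" "t \<in> tail x 1" "u = b + t" by (auto elim: set_plus_elim)
      have "b \<in> span (insert a (C - {a}))" using bt C by (auto simp: insert_absorb)
      then obtain k where "b - scale k a \<in> H" unfolding span_insert H_def by blast
      moreover have "scale k a \<in> ?F" using aF F by (intro subspace_scale)
      moreover have u: "u = ((b - scale k a) + t) + scale k a" using bt by simp
      ultimately show ?thesis using bt(2) by (subst u) (intro set_plus_intro)
    qed
    then have "H + tail x 1 = UNIV"
      using H by (intro nongen[OF subalgebra_subspace_A(1)] UNIV_eq_I) auto
    then have "a \<in> H + tail x 1" by simp
    then obtain h t where ht: "h \<in> H" "t \<in> tail x 1" "a = h + t" by (auto elim: set_plus_elim)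
    have "a - h \<in> A" using 1 ht H by (intro subspace_diff[OF subspace_A]) auto
    then have "t \<in> A" using ht by simp
    then have "t = 0" using A_inter ht by auto
    then show False using ht aH by simp
  qed
  ultimately show "v \<in> tail x 2" using 1 by simp
qed

text \<open>The witnesses are the images of \<open>A\<close> and \<open>x\<close>. For equal factors
  the \<open>A\<close>-part in \<open>bracket_decomposition\<close> cancels, so squares lie in
  \<open>tail x 2\<close>.\<close>

lemma almost_abelian_quotient: "almost_abelian_lie_algebra (quotient (tail x 2))"
proof -
  let ?N = "tail x 2"
  note q = quotient_add[OF subspace_tail] quotient_smul[OF subspace_tail] quotient_brk[OF ideal_tail]
    zer_quotient coset_eq_iff[OF subspace_tail] carr_quotient
  have "bracket v v \<in> ?N" for v
  proof -
    obtain a c w where 1: "a \<in> A" "w \<in> tail x 2" "v = a + scale c x + w" by (rule decomposition)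
    then show ?thesis
      unfolding 1 by (subst bracket_decomposition) (auto intro!: subspace_scale bracket_in_tail_2)
  qed
  then have "lie_algebra_on (quotient ?N)"
    by (intro lie_algebra_on_quotient ideal_tail)
  moreover have "abelian_ideal_on (quotient ?N) ((\<lambda>a. a +o ?N) ` A)"
    unfolding abelian_ideal_on_def
  proof (intro conjI ballI allI)
    show "zer (quotient ?N) \<in> (\<lambda>a. a +o ?N) ` A"
      using subspace_0[OF subspace_A] by (simp only: zer_quotient) (rule imageI)
  qed (use abelian_A in \<open>auto simp: q abelian_def subspace_0 ideal_bracket[OF ideal_A]
      subspace_add[OF subspace_A] subspace_scale[OF subspace_A] intro!: imageI simp del: set_zero_plus\<close>)
  moreover have "(\<lambda>a. a +o ?N) ` A \<noteq> {zer (quotient ?N)}"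
  proof -
    obtain a where a: "a \<in> A" "a \<noteq> 0" using A_nonzero subspace_0[OF subspace_A] by auto
    then have "a \<notin> ?N" using A_inter tail_mono[of 1 2 x] by auto
    then have "a +o ?N \<noteq> zer (quotient ?N)" by (simp add: q del: set_zero_plus)
    then show ?thesis using a by auto
  qed
  moreover have "carr (quotient ?N) =
    {add (quotient ?N) a (smul (quotient ?N) c (x +o ?N)) | a c. a \<in> (\<lambda>a. a +o ?N) ` A}" (is "_ = ?S")
  proof
    show "?S \<subseteq> carr (quotient ?N)" by (auto simp: q)
    show "carr (quotient ?N) \<subseteq> ?S"
    proof
      fix X assume "X \<in> carr (quotient ?N)"
      then obtain v where "X = v +o ?N" by (auto simp: q)
      moreover obtain a c w where "a \<in> A" "w \<in> tail x 2" "v = a + scale c x + w" by (rule decomposition)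
      ultimately have "X = add (quotient ?N) (a +o ?N) (smul (quotient ?N) c (x +o ?N))" "a \<in> A"
        by (simp_all add: q)
      then show "X \<in> ?S" by blast
    qed
  qed
  moreover have "\<forall>a\<in>(\<lambda>a. a +o ?N) ` A. brk (quotient ?N) a (x +o ?N) = a \<and>
      brk (quotient ?N) (x +o ?N) a = smul (quotient ?N) (- 1) a"
    by (auto simp: q A_x x_A subspace_0)
  moreover have "x +o ?N \<in> carr (quotient ?N)" unfolding carr_quotient by (rule rangeI)
  ultimately show ?thesis unfolding almost_abelian_lie_algebra_def by blast
qed

end

section \<open>Pairs of weak quasi-ideals\<close>

text \<open>Fitting decomposition: the images of the iterates stabilise, so
  \<open>(T ^^ N) v\<close> equals \<open>(T ^^ (N + N)) w\<close> for some \<open>w\<close>. The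
  bound on \<open>N\<close> serves maps whose second iterate already has values in the Frattini
  ideal.\<close>

lemma (in finite_dimensional_vector_space) fitting:
  assumes T: "Vector_Spaces.linear scale scale T" and U: "subspace U" "T ` U \<subseteq> U"
  obtains N where "N \<ge> 2" "\<And>v. v \<in> U \<Longrightarrow> \<exists>w\<in>U. (T ^^ N) (v - (T ^^ N) w) = 0"
proof -
  interpret T: Vector_Spaces.linear scale scale T by fact
  define S where "S i = (T ^^ i) ` U" for i
  have S_Suc: "S (Suc i) = T ` S i" for i by (auto simp: S_def)
  have sub: "subspace (S i)" for i
    by (induction i) (auto simp: S_Suc T.subspace_image U(1), simp add: S_def U(1))
  have "S (Suc i) \<subseteq> S i" for i
  proof (induction i)
    case 0
    then show ?case using U(2) by (simp add: S_def)
  next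
    case (Suc i)
    then show ?case unfolding S_Suc[of "Suc i"] S_Suc[of i] by (rule image_mono)
  qed
  then have anti: "S j \<subseteq> S i" if "i \<le> j" for i j
    using that by (rule lift_Suc_antimono_le)
  obtain i where i: "\<And>j. dim (S i) \<le> dim (S j)"
    using ex_has_least_nat[of "\<lambda>_. True" undefined "\<lambda>i. dim (S i)"] by auto
  have eq: "S j = S i" if "i \<le> j" for j
    using subspace_dim_equal[OF sub sub anti[OF that] i] .
  define N where "N = Suc (Suc i)"
  have diff: "(T ^^ k) (u - v) = (T ^^ k) u - (T ^^ k) v" for k u v
    by (induction k) (simp_all add: T.diff)
  show thesis
  proof (rule that[of N])
    show "N \<ge> 2" by (simp add: N_def)
    fix v assume "v \<in> U"
    then have "(T ^^ N) v \<in> S N" by (simp add: S_def)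
    also have "S N = S (N + N)" using eq[of N] eq[of "N + N"] by (simp add: N_def)
    finally obtain w where "w \<in> U" "(T ^^ N) v = (T ^^ (N + N)) w" by (auto simp: S_def)
    then show "\<exists>w\<in>U. (T ^^ N) (v - (T ^^ N) w) = 0"
      by (intro bexI[of _ w]) (simp_all add: diff funpow_add)
  qed
qed

lemma funpow_mem: "(\<And>z. z \<in> S \<Longrightarrow> T z \<in> S) \<Longrightarrow> z \<in> S \<Longrightarrow> (T ^^ i) z \<in> S"
  by (induction i) auto

context vector_space
begin

lemma funpow_eigenvalue_mod:
  assumes T: "Vector_Spaces.linear scale scale T" and J: "subspace J" "\<And>z. z \<in> J \<Longrightarrow> T z \<in> J"
    and z: "T z - scale c z \<in> J"
  shows "(T ^^ i) z - scale (c ^ i) z \<in> J"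
proof (induction i)
  case 0
  then show ?case using J by (simp add: subspace_0)
next
  case (Suc i)
  interpret T: Vector_Spaces.linear scale scale T by fact
  have "T ((T ^^ i) z - scale (c ^ i) z) + scale (c ^ i) (T z - scale c z) \<in> J"
    using Suc z J by (intro subspace_add subspace_scale) auto
  then show ?case by (simp add: T.diff T.scale scale_right_diff_distrib mult.commute)
qed

text \<open>If \<open>T\<close> has trivial kernel on \<open>S\<close> modulo \<open>J\<close>, then
  so do its iterates.\<close>

lemma mem_if_funpow_mem:
  assumes "\<And>z. z \<in> S \<Longrightarrow> T z \<in> S" "\<And>z. z \<in> S \<Longrightarrow> T z \<in> J \<Longrightarrow> z \<in> J"
    and "z \<in> S" "(T ^^ i) z \<in> J"
  shows "z \<in> J"
  using assms(3,4)
proof (induction i arbitrary: z)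
  case (Suc i)
  then show ?case using assms(1,2) by (simp add: funpow_swap1)
qed simp

end

context leibniz_algebra
begin

section \<open>Iterated right multiplication and the exact weight relations\<close>

lemma linear_bracket_left_diff: "Vector_Spaces.linear scale scale (\<lambda>z. bracket z x - z)"
  by (simp add: Vector_Spaces.linear_iff bracket_simps scale_right_diff_distrib vector_space_axioms)

lemma pow_funpow: "pow x (Suc k) = ((\<lambda>z. bracket z x) ^^ k) x"
  by (simp add: pow_def)

lemma funpow_bracket_add: "((\<lambda>z. bracket z x) ^^ k) (u + v) =
    ((\<lambda>z. bracket z x) ^^ k) u + ((\<lambda>z. bracket z x) ^^ k) v"
  and funpow_bracket_scale: "((\<lambda>z. bracket z x) ^^ k) (scale c u) = scale c (((\<lambda>z. bracket z x) ^^ k) u)"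
  and funpow_bracket_zero: "((\<lambda>z. bracket z x) ^^ k) 0 = 0"
  by (induction k) (simp_all add: bracket_simps)

lemma funpow_bracket_tail:
  "z \<in> tail x k \<Longrightarrow> k \<ge> 1 \<Longrightarrow> ((\<lambda>z. bracket z x) ^^ i) z \<in> tail x (k + i)"
  by (induction i) (auto intro: bracket_tail)

lemma tail_subset_ideal:
  assumes I: "ideal I" and x: "bracket x x \<in> I"
  shows "tail x 2 \<subseteq> I"
proof (rule tail_subset[OF subspace_if_ideal[OF I]])
  fix j :: nat assume "2 \<le> j"
  then show "pow x j \<in> I"
    by (induction j rule: dec_induct) (use assms in \<open>auto simp: pow_2 pow_Suc ideal_bracket\<close>)
qed

lemma subspace_bracket_image: "subspace S \<Longrightarrow> subspace ((\<lambda>z. bracket z a) ` S)"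
proof -
  interpret l: Vector_Spaces.linear scale scale "\<lambda>z. bracket z a" by (rule linear_bracket_left)
  show "subspace S \<Longrightarrow> ?thesis" by (rule l.subspace_image)
qed

text \<open>In the application \<open>I\<close> is the Frattini ideal. \<open>indep\<close> makes
  \<open>x\<close> and \<open>a\<close> independent modulo \<open>I\<close>, and \<open>gen\<close>
  puts \<open>a\<close> into the generalised eigenspace of \<open>R\<close> for the eigenvalue 1.
  The errors \<open>f\<close>, \<open>g\<close> and \<open>b\<close> are first pushed into
  \<open>J = N K\<close> and then die because \<open>J = N J\<close>.\<close>

lemma bracket_eq_if_weak_quasi_ideals:
  assumes two: "(2 :: 'a) \<noteq> 0"
    and wq: "\<And>U V u v. subalgebra U \<Longrightarrow> subalgebra V \<Longrightarrow> u \<in> U \<Longrightarrow> v \<in> V \<Longrightarrow> bracket u v \<in> U + V"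
    and I: "ideal I"
    and ax: "bracket a x - a \<in> I" and xa: "bracket x a + a \<in> I"
    and xx: "bracket x x \<in> I" and aa: "bracket a a \<in> I"
    and indep: "\<And>c d. scale c x + scale d a \<in> I \<Longrightarrow> c = 0 \<and> d = 0"
    and nil_x: "pow x (Suc n) = 0"
    and nil_a: "\<And>z. ((\<lambda>z. bracket z a) ^^ m) z = 0"
    and gen: "((\<lambda>z. bracket z x - z) ^^ M) a = 0"
  shows "bracket a x = a" "bracket x a = - a" "bracket a a = 0"
proof -
  define R where "R = (\<lambda>z. bracket z x)"
  define N where "N = (\<lambda>z. bracket z a)"
  define D where "D = (\<lambda>z. R z - z)"
  define b where "b = bracket a a"
  define f where "f = bracket a x - a"
  define g where "g = bracket x a + a"
  define K where "K = tail x 2 + tail a 2"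
  define J where "J = N ` K"
  interpret R: Vector_Spaces.linear scale scale R
    unfolding R_def by (rule linear_bracket_left)
  interpret N: Vector_Spaces.linear scale scale N
    unfolding N_def by (rule linear_bracket_left)
  interpret D: Vector_Spaces.linear scale scale D
    unfolding D_def R_def by (rule linear_bracket_left_diff)
  have sI: "subspace I" using I by (rule subspace_if_ideal)
  have Ra: "R a = a + f" and Nx: "N x = - a + g" and Na: "N a = b" "pow a 2 = b"
    by (simp_all add: R_def f_def N_def g_def b_def pow_2)
  have sK: "subspace K" unfolding K_def by (intro subspace_set_plus subspace_tail)
  have tails_K: "tail x 2 \<subseteq> K" "tail a 2 \<subseteq> K"
    unfolding K_def by (auto intro!: subset_set_plus_left subset_set_plus_right subspace_tail)
  have tails_I: "tail x 2 \<subseteq> I" "tail a 2 \<subseteq> I"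
    using tail_subset_ideal I xx aa by auto
  have K_right: "bracket z k = 0" if "k \<in> K" for z k
    using that unfolding K_def by (auto elim!: set_plus_elim simp: bracket_simps bracket_tail_right)
  have KI: "K \<subseteq> I"
    using set_plus_subset_subspace[OF sI tails_I] by (simp add: K_def)
  \<comment> \<open>Together with \<open>KI\<close> and \<open>KW\<close> this identifies
    \<open>K\<close> as the intersection of \<open>I\<close> with
    \<open>tail x 1 + tail a 1\<close>, whence its invariance under \<open>R\<close> and
    \<open>N\<close>.\<close>
  have K_if: "k \<in> K" if k: "k \<in> I" "k \<in> tail x 1 + tail a 1" for k
  proof -
    obtain p q where pq: "p \<in> tail x 1" "q \<in> tail a 1" "k = p + q"
      using k(2) by (rule set_plus_elim)
    obtain c p' where p: "p' \<in> tail x 2" "p = scale c x + p'" using pq(1) by (rule tail_1E)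
    obtain d q' where q: "q' \<in> tail a 2" "q = scale d a + q'" using pq(2) by (rule tail_1E)
    have "k - p' - q' \<in> I" using k(1) p(1) q(1) tails_I by (intro subspace_diff[OF sI]) auto
    then have "scale c x + scale d a \<in> I" by (simp add: pq p q algebra_simps)
    then have "c = 0 \<and> d = 0" by (rule indep)
    then show ?thesis using p q pq by (auto simp: K_def)
  qed
  have W_subspace: "subspace (tail x 1 + tail a 1)" by (intro subspace_set_plus subspace_tail)
  have tails_W: "tail x 1 \<subseteq> tail x 1 + tail a 1" "tail a 1 \<subseteq> tail x 1 + tail a 1"
    by (auto intro!: subset_set_plus_left subset_set_plus_right subspace_tail)
  have KW: "K \<subseteq> tail x 1 + tail a 1"
    unfolding K_def using tail_mono[of 1 2] by (intro set_plus_mono2) auto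
  have xs: "subalgebra (tail x 1)" and as: "subalgebra (tail a 1)" by (auto intro: subalgebra_tail)
  have RW: "R z \<in> tail x 1 + tail a 1" if z: "z \<in> tail x 1 + tail a 1" for z
  proof -
    obtain p q where pq: "p \<in> tail x 1" "q \<in> tail a 1" "z = p + q"
      using z by (rule set_plus_elim)
    have "bracket p x \<in> tail x 1 + tail a 1"
      using subalgebra_bracket[OF xs pq(1) self_in_tail] tails_W by blast
    moreover have "bracket q x \<in> tail x 1 + tail a 1"
      using wq[OF as xs pq(2) self_in_tail] by (metis add.commute)
    ultimately show ?thesis
      unfolding R_def pq bracket_add_left by (rule subspace_add[OF W_subspace])
  qed
  have NW: "N z \<in> tail x 1 + tail a 1" if z: "z \<in> tail x 1 + tail a 1" for z
  proof -
    obtain p q where pq: "p \<in> tail x 1" "q \<in> tail a 1" "z = p + q"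
      using z by (rule set_plus_elim)
    have "bracket q a \<in> tail x 1 + tail a 1"
      using subalgebra_bracket[OF as pq(2) self_in_tail] tails_W by blast
    with wq[OF xs as pq(1) self_in_tail] show ?thesis
      unfolding N_def pq bracket_add_left by (rule subspace_add[OF W_subspace])
  qed
  have RK: "R z \<in> K" and NK: "N z \<in> K" if "z \<in> K" for z
  proof -
    have "z \<in> I" "z \<in> tail x 1 + tail a 1" using that KI KW by blast+
    then show "R z \<in> K" "N z \<in> K"
      using RW NW ideal_bracket[OF I] by (auto intro!: K_if simp only: R_def N_def)
  qed
  have xW: "x \<in> tail x 1 + tail a 1" and aW: "a \<in> tail x 1 + tail a 1"
    using tails_W self_in_tail by blast+
  have fK: "f \<in> K" and gK: "g \<in> K"
    using ax xa RW[OF aW] NW[OF xW] aW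
    by (auto intro!: K_if simp: f_def g_def R_def N_def intro: subspace_diff[OF W_subspace] subspace_add[OF W_subspace])
  have bK: "b \<in> K" using tails_K pow_in_tail[of 2 2 a] by (auto simp: Na)
  have sJ: "subspace J" unfolding J_def N_def by (rule subspace_bracket_image[OF sK])
  have JK: "J \<subseteq> K" using NK by (auto simp: J_def)
  have NJ: "N z \<in> J" if "z \<in> K" for z using that by (simp add: J_def)
  \<comment> \<open>The derivation rule leaves right multiplication by \<open>a + f\<close>, and
    \<open>f\<close> acts as zero because it lies in \<open>K\<close>.\<close>
  have comm: "R (N z) = N (R z) + N z" for z
  proof -
    have "R (N z) = N (R z) + bracket z (a + f)"
      using bracket_derivation[of z a x] Ra by (simp add: R_def N_def)
    then show ?thesis using fK by (simp add: bracket_simps K_right N_def)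
  qed
  have RJ: "R z \<in> J" if z: "z \<in> J" for z
  proof -
    obtain k where "k \<in> K" "z = N k" using z by (auto simp: J_def)
    then show ?thesis using subspace_add[OF sJ NJ NJ] RK by (simp add: comm)
  qed
  have scale_2: "scale 2 z = z + z" for z
    using scale_left_distrib[of 1 1 z] by simp
  have Rb: "R b = scale 2 b + N f"
    using comm[of a] by (simp add: Na Ra N.add scale_2)
  have Rb_J: "R b - scale 2 b \<in> J" using NJ fK by (simp add: Rb)
  have a3_J: "tail a 3 \<subseteq> J"
  proof (rule tail_subset[OF sJ])
    fix j :: nat assume "3 \<le> j"
    then obtain i where i: "j = Suc i" "i \<ge> 2" by (cases j) auto
    then have "pow a i \<in> K" using tails_K pow_in_tail[of 2 i a] by auto
    then show "pow a j \<in> J" using NJ i by (auto simp: pow_Suc N_def)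
  qed
  have tail_a2: "\<exists>t. s - scale t b \<in> tail a 3" if "s \<in> tail a 2" for s
    using that tail_Suc_iff[of s a 2] by (simp add: Na)
  have K_dec: "\<exists>t q. q \<in> tail x 2 \<and> k - scale t b - q \<in> J" if k: "k \<in> K" for k
  proof -
    obtain q s where qs: "q \<in> tail x 2" "s \<in> tail a 2" "k = q + s"
      using k unfolding K_def by (rule set_plus_elim)
    moreover obtain t where "s - scale t b \<in> tail a 3"
      using tail_a2[OF qs(2)] by blast
    ultimately show ?thesis using a3_J
      by (intro exI[of _ t] exI[of _ q]) (auto simp: algebra_simps)
  qed
  have Rn: "(R ^^ n) q = 0" if "q \<in> tail x 2" for q
    using funpow_bracket_tail[OF that, of n] tail_eq_0[OF nil_x, of "2 + n"] by (simp add: R_def)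
  have Rn_linear: "(R ^^ n) (u + v) = (R ^^ n) u + (R ^^ n) v" "(R ^^ n) (scale c u) = scale c ((R ^^ n) u)"
    for u v c
    by (simp_all add: R_def funpow_bracket_add funpow_bracket_scale)
  have linR: "Vector_Spaces.linear scale scale R" by unfold_locales
  have linD: "Vector_Spaces.linear scale scale D" by unfold_locales
  have Rnb: "(R ^^ n) b - scale (2 ^ n) b \<in> J"
    by (rule funpow_eigenvalue_mod[OF linR sJ RJ Rb_J])
  \<comment> \<open>Modulo \<open>J\<close>, the operator \<open>R\<close> is annihilated by \<open>R\<^sup>n (R - 2)\<close> on \<open>K\<close>, so \<open>D = R - 1\<close> is injective there.\<close>
  have D_inj: "k \<in> J" if k: "k \<in> K" and Dk: "D k \<in> J" for k
  proof -
    obtain t q where tq: "q \<in> tail x 2" "k - scale t b - q \<in> J" using K_dec[OF k] by blast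
    define j where "j = k - scale t b - q"
    have k_eq: "k = scale t b + q + j" by (simp add: j_def)
    have jJ: "j \<in> J" using tq by (simp add: j_def)
    \<comment> \<open>Modulo \<open>J\<close>, \<open>R ^^ n\<close> fixes \<open>k\<close>, kills
      \<open>q\<close> and multiplies \<open>b\<close> by a scalar, so \<open>k\<close> is a
      multiple of \<open>b\<close>.\<close>
    have "(R ^^ n) k - scale (1 ^ n) k \<in> J"
      using Dk by (intro funpow_eigenvalue_mod[OF linR sJ RJ]) (simp_all add: D_def)
    then have 1: "(R ^^ n) k - k \<in> J" by simp
    have 2: "(R ^^ n) j \<in> J" using RJ jJ by (rule funpow_mem)
    define s where "s = 2 ^ n * t"
    have "scale t ((R ^^ n) b - scale (2 ^ n) b) + (R ^^ n) j - ((R ^^ n) k - k) \<in> J"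
      by (rule subspace_diff[OF sJ subspace_add[OF sJ subspace_scale[OF sJ Rnb] 2] 1])
    moreover have "(R ^^ n) k = scale t ((R ^^ n) b) + (R ^^ n) j"
      unfolding k_eq by (simp add: Rn_linear Rn[OF tq(1)])
    ultimately have 3: "k - scale s b \<in> J"
      by (simp add: s_def algebra_simps)
    define i where "i = k - scale s b"
    have "k = scale s b + i" by (simp add: i_def)
    then have "R k = scale s (R b) + R i" by (simp add: R.add R.scale)
    \<comment> \<open>On multiples of \<open>b\<close>, \<open>R\<close> acts as 2 and hence
      \<open>D\<close> as the identity, modulo \<open>J\<close>.\<close>
    then have "k = D k - (scale s (R b - scale 2 b) + (R i - scale 2 i))"
      unfolding D_def by (simp add: i_def scale_2 scale_right_distrib scale_right_diff_distrib del: scale_scale)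
    moreover have "R i - scale 2 i \<in> J"
      using RJ 3 subspace_scale[OF sJ] subspace_diff[OF sJ] by (simp add: i_def)
    then have "D k - (scale s (R b - scale 2 b) + (R i - scale 2 i)) \<in> J"
      by (rule subspace_diff[OF sJ Dk subspace_add[OF sJ subspace_scale[OF sJ Rb_J]]])
    ultimately show ?thesis by simp
  qed
  have DK: "D z \<in> K" if "z \<in> K" for z
    using that RK subspace_diff[OF sK] by (simp add: D_def)
  \<comment> \<open>\<open>f\<close> is \<open>D a\<close>, so \<open>gen\<close> makes an iterate
    of \<open>D\<close> vanish on it.\<close>
  have fJ: "f \<in> J"
  proof (rule mem_if_funpow_mem[of K D J f M])
    have "(D ^^ M) f = (D ^^ M) (D a)" by (simp add: D_def Ra)
    also have "\<dots> = D ((D ^^ M) a)" by (simp add: funpow_swap1)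
    also have "(D ^^ M) a = 0" using gen by (simp only: D_def R_def)
    also have "D 0 = 0" by (rule D.zero)
    finally show "(D ^^ M) f \<in> J" using subspace_0[OF sJ] by simp
  qed (use DK D_inj fK in blast)+
  \<comment> \<open>Since \<open>bracket x a\<close> is \<open>- a\<close> up to an element of
    \<open>K\<close>, raising the power of \<open>x\<close> by one applies \<open>D\<close>.
    Nilpotency of \<open>x\<close> then makes \<open>D g - f\<close> vanish under
    \<open>D ^^ n\<close>.\<close>
  have N_pow_x: "N (pow x (2 + i)) = (D ^^ i) (D g - f)" for i
  proof (induction i)
    case 0
    have "N (pow x 2) = R (N x) + bracket x (- a + g)"
      using bracket_derivation[of x x a] Nx by (simp add: pow_2 R_def N_def)
    also have "\<dots> = R (N x) - N x"
      using gK by (simp add: bracket_simps K_right N_def)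
    finally show ?case by (simp add: R.add R.neg R.diff Ra Nx D_def)
  next
    case (Suc i)
    have "N (pow x (2 + Suc i)) = R (N (pow x (2 + i))) + bracket (pow x (2 + i)) (- a + g)"
      using bracket_derivation[of "pow x (2 + i)" x a] Nx pow_Suc[of "2 + i" x] by (simp add: R_def N_def)
    also have "\<dots> = D (N (pow x (2 + i)))"
      using gK by (simp add: bracket_simps K_right D_def N_def)
    finally show ?case using Suc by simp
  qed
  have "pow x (2 + n) = 0"
    using tail_eq_0[OF nil_x, of "2 + n"] pow_in_tail[of "2 + n" "2 + n" x] by simp
  then have Dn: "(D ^^ n) (D g - f) \<in> J"
    using N_pow_x[of n] subspace_0[OF sJ] by (simp add: N.zero)
  have DgK: "D g - f \<in> K" by (rule subspace_diff[OF sK DK[OF gK] fK])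
  have "D g - f \<in> J"
    by (rule mem_if_funpow_mem[of K D J _ n]) (use DK D_inj DgK Dn in blast)+
  then have "D g - f + f \<in> J" using fJ by (rule subspace_add[OF sJ])
  then have gJ: "g \<in> J" using D_inj[OF gK] by simp
  \<comment> \<open>Comparing the subalgebras of \<open>u = x + a - a\<^sup>2 / 2\<close> and \<open>x\<close>, whose squares agree modulo \<open>J\<close>, forces \<open>b \<in> J\<close>.\<close>
  define u where "u = x + a - scale (1 / 2) b"
  define Q where "Q = tail x 2 + J"
  have sQ: "subspace Q" unfolding Q_def by (intro subspace_set_plus subspace_tail sJ)
  have in_Q: "tail x 2 \<subseteq> Q" "J \<subseteq> Q"
    unfolding Q_def by (auto intro!: subset_set_plus_left subset_set_plus_right subspace_tail sJ)
  have QK: "Q \<subseteq> K" unfolding Q_def by (rule set_plus_subset_subspace[OF sK tails_K(1) JK])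
  have bracket_u: "bracket z u = R z + N z" for z
    using bK by (simp add: u_def bracket_simps K_right R_def N_def)
  have Ru: "R u = pow x 2 + (a + f) - scale (1 / 2) (R b)"
    using Ra by (simp add: u_def R.add R.diff R.scale) (simp add: R_def pow_2)
  have x2_Q: "pow x 2 \<in> Q" using in_Q pow_in_tail[of 2 2 x] by blast
  have half: "scale (1 / 2) (R b) = b + scale (1 / 2) (N f)"
    using two by (simp add: Rb scale_right_distrib)
  have tail_u: "tail u 2 \<subseteq> Q"
  proof (rule tail_subset[OF sQ])
    fix j :: nat assume "2 \<le> j"
    then show "pow u j \<in> Q"
    proof (induction j rule: dec_induct)
      case base
      \<comment> \<open>The \<open>b\<close> coming from \<open>N a\<close> cancels against half of
        \<open>R b\<close>; the correction term in \<open>u\<close> is chosen for this.\<close>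
      have "pow u 2 = pow x 2 + f + g - scale (1 / 2) (N f) - scale (1 / 2) (N b)"
        unfolding pow_2[of u] bracket_u Ru half
        by (simp add: u_def N.add N.diff N.scale Nx Na)
      also have "\<dots> \<in> Q"
        using fJ gJ NJ[OF fK] NJ[OF bK] in_Q x2_Q
        by (intro subspace_add[OF sQ] subspace_diff[OF sQ] subspace_scale[OF sQ]) auto
      finally show ?case .
    next
      case (step j)
      obtain q i where qi: "q \<in> tail x 2" "i \<in> J" "pow u j = q + i"
        using step(3) unfolding Q_def by (rule set_plus_elim)
      have "R q \<in> tail x 2"
        using bracket_tail[OF _ qi(1)] tail_mono[of 2 3 x] by (auto simp: R_def numeral_3_eq_3 numeral_2_eq_2)
      then have "R q + (R i + N (q + i)) \<in> Q"
        using RJ[OF qi(2)] NJ step(3) QK in_Q qi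
        by (intro subspace_add[OF sQ]) auto
      then show ?case
        using step qi by (simp add: pow_Suc bracket_u R.add add.assoc)
    qed
  qed
  have bJ: "b \<in> J"
  proof -
    have "R u \<in> tail u 1 + tail x 1"
      unfolding R_def by (intro wq subalgebra_tail self_in_tail) auto
    then obtain p q where pq: "p \<in> tail u 1" "q \<in> tail x 1" "R u = p + q" by (rule set_plus_elim)
    obtain c p' where p: "p' \<in> tail u 2" "p = scale c u + p'" using pq(1) by (rule tail_1E)
    obtain d q' where q: "q' \<in> tail x 2" "q = scale d x + q'" using pq(2) by (rule tail_1E)
    have inQ: "p' \<in> Q" "q' \<in> Q" using p q tail_u in_Q by auto
    have eq: "pow x 2 + (a + f) - (b + scale (1 / 2) (N f)) =
        scale c (x + a - scale (1 / 2) b) + p' + (scale d x + q')"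
      using pq(3) unfolding p(2) q(2) Ru half by (simp only: u_def)
    have "pow x 2 + f - (b + scale (1 / 2) (N f)) - p' - q' + scale c (scale (1 / 2) b) \<in> K"
      using x2_Q fK bK NK[OF fK] inQ QK
      by (intro subspace_add[OF sK] subspace_diff[OF sK] subspace_scale[OF sK]) auto
    also have "pow x 2 + f - (b + scale (1 / 2) (N f)) - p' - q' + scale c (scale (1 / 2) b) =
        (pow x 2 + (a + f) - (b + scale (1 / 2) (N f))) - a - p' - q' + scale c (scale (1 / 2) b)"
      by (simp add: algebra_simps)
    also have "\<dots> = scale (c + d) x + scale (c - 1) a"
      unfolding eq by (simp add: algebra_simps)
    \<comment> \<open>The coefficients of \<open>x\<close> and \<open>a\<close> are compared modulo
      \<open>I\<close>.\<close>
    finally have "c + d = 0 \<and> c - 1 = 0" using KI by (intro indep) auto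
    then have cd: "c = 1" "d = - 1" by (auto simp: eq_neg_iff_add_eq_0 add.commute)
    have "scale (1 / 2) b = b - scale (1 / 2) b"
      using scale_left_diff_distrib[of 1 "1 / 2" b] two by (simp add: field_simps)
    also have "\<dots> = pow x 2 + f - scale (1 / 2) (N f) - p' - q'"
      using eq cd by (simp add: algebra_simps)
    also have "\<dots> \<in> Q"
      using x2_Q fJ NJ[OF fK] inQ in_Q
      by (intro subspace_add[OF sQ] subspace_diff[OF sQ] subspace_scale[OF sQ]) auto
    finally have "scale 2 (scale (1 / 2) b) \<in> Q" by (rule subspace_scale[OF sQ])
    then have "b \<in> Q" using two by simp
    then obtain q i where qi: "q \<in> tail x 2" "i \<in> J" "b = q + i" unfolding Q_def by (rule set_plus_elim)
    \<comment> \<open>\<open>R ^^ n\<close> removes the component in \<open>tail x 2\<close> but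
      multiplies \<open>b\<close> by the nonzero scalar \<open>2 ^ n\<close> modulo
      \<open>J\<close>.\<close>
    have "(R ^^ n) b = (R ^^ n) i" unfolding qi(3) Rn_linear by (simp add: Rn qi)
    then have "(R ^^ n) b \<in> J" using RJ qi(2) by (simp add: funpow_mem)
    then have "(R ^^ n) b - ((R ^^ n) b - scale (2 ^ n) b) \<in> J" using Rnb by (rule subspace_diff[OF sJ])
    then have "scale (2 ^ n) b \<in> J" by simp
    then have "scale (1 / 2 ^ n) (scale (2 ^ n) b) \<in> J" by (rule subspace_scale[OF sJ])
    then show ?thesis using two by simp
  qed
  have a2_J: "tail a 2 \<subseteq> J"
  proof
    fix s assume "s \<in> tail a 2"
    then obtain t where "s - scale t b \<in> J"
      using a3_J tail_a2 by blast
    then have "s - scale t b + scale t b \<in> J"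
      using bJ by (intro subspace_add[OF sJ] subspace_scale[OF sJ])
    then show "s \<in> J" by simp
  qed
  define J2 where "J2 = N ` J"
  have sJ2: "subspace J2" unfolding J2_def N_def by (rule subspace_bracket_image[OF sJ])
  have J2J: "J2 \<subseteq> J" using NJ JK by (auto simp: J2_def)
  have NJ2: "N z \<in> J2" if "z \<in> J" for z using that by (simp add: J2_def)
  have RJ2: "R z \<in> J2" if z: "z \<in> J2" for z
  proof -
    obtain k where "k \<in> J" "z = N k" using z by (auto simp: J2_def)
    then show ?thesis using subspace_add[OF sJ2 NJ2 NJ2] RJ by (simp add: comm)
  qed
  have DJ2: "D z \<in> J2" if "z \<in> J2" for z
    using that RJ2 subspace_diff[OF sJ2] by (simp add: D_def)
  \<comment> \<open>\<open>D\<close> is nilpotent on \<open>J / N J\<close>, because \<open>D N = N R\<close> and \<open>R\<close> is nilpotent on \<open>K / J\<close>.\<close>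
  have D_nil: "(D ^^ n) z \<in> J2" if z: "z \<in> J" for z
  proof -
    obtain k where k: "k \<in> K" "z = N k" using z by (auto simp: J_def)
    obtain q s where qs: "q \<in> tail x 2" "s \<in> tail a 2" "k = q + s"
      using k(1) unfolding K_def by (rule set_plus_elim)
    have "(D ^^ i) (N k) = N ((R ^^ i) k)" for i
      by (induction i) (simp_all add: D_def comm)
    then have "(D ^^ n) z = N ((R ^^ n) s)"
      by (simp add: k(2) qs(3) Rn_linear Rn qs(1))
    moreover have "(R ^^ n) s \<in> J" using RJ qs(2) a2_J by (auto intro: funpow_mem)
    ultimately show ?thesis using NJ2 by simp
  qed
  \<comment> \<open>Modulo \<open>J2\<close>, \<open>b\<close> is fixed by \<open>D\<close>, which
    is nilpotent there.\<close>
  have bJ2: "b \<in> J2"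
  proof -
    have "D b - scale 1 b = N f" by (simp add: D_def Rb scale_2)
    then have "(D ^^ n) b - scale (1 ^ n) b \<in> J2"
      using NJ2[OF fJ] by (intro funpow_eigenvalue_mod[OF linD sJ2 DJ2]) auto
    then have "(D ^^ n) b - ((D ^^ n) b - scale (1 ^ n) b) \<in> J2"
      by (rule subspace_diff[OF sJ2 D_nil[OF bJ]])
    then show ?thesis by simp
  qed
  have a2_J2: "tail a 2 \<subseteq> J2"
  proof (rule tail_subset[OF sJ2])
    fix j :: nat assume "2 \<le> j"
    then show "pow a j \<in> J2"
    proof (induction j rule: dec_induct)
      case base
      then show ?case using bJ2 by (simp add: Na)
    next
      case (step j)
      then have "N (pow a j) \<in> J2" using J2J NJ2 by blast
      then show ?case using step by (simp add: pow_Suc N_def)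
    qed
  qed
  \<comment> \<open>\<open>R\<close> is nilpotent on \<open>tail x 2\<close>, so \<open>D\<close>
    has trivial kernel there modulo \<open>J2\<close>, whereas \<open>D_nil\<close> makes it
    nilpotent.\<close>
  have x2_J2: "q \<in> J2" if q: "q \<in> tail x 2" "q \<in> J" for q
  proof (rule mem_if_funpow_mem[of "tail x 2" D J2 q n])
    have R2: "R z \<in> tail x 2" if "z \<in> tail x 2" for z
      using bracket_tail[OF _ that] tail_mono[of 2 3 x] by (auto simp: R_def numeral_3_eq_3 numeral_2_eq_2)
    show "D z \<in> tail x 2" if "z \<in> tail x 2" for z
      using R2[OF that] that by (simp add: D_def subspace_diff)
    show "z \<in> J2" if z: "z \<in> tail x 2" "D z \<in> J2" for z
    proof -
      have "(R ^^ n) z - scale (1 ^ n) z \<in> J2"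
        using z(2) by (intro funpow_eigenvalue_mod[OF linR sJ2 RJ2]) (simp_all add: D_def)
      then show ?thesis using Rn[OF z(1)] subspace_neg[OF sJ2, of "- z"] by simp
    qed
  qed (use q D_nil in auto)
  have JJ2: "J \<subseteq> J2"
  proof
    fix z assume z: "z \<in> J"
    then obtain q s where qs: "q \<in> tail x 2" "s \<in> tail a 2" "z = q + s"
      using JK unfolding K_def by (blast elim: set_plus_elim)
    have "z - s \<in> J" using z qs a2_J by (intro subspace_diff[OF sJ]) auto
    then have "q \<in> J" using qs by simp
    then have "q \<in> J2" using qs x2_J2 by simp
    then show "z \<in> J2" using qs a2_J2 subspace_add[OF sJ2] by auto
  qed
  \<comment> \<open>Iterating \<open>J = N J\<close>; the exponent \<open>m\<close> from
    \<open>nil_a\<close> leaves only zero.\<close>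
  have J_pow: "\<exists>k\<in>J. z = (N ^^ i) k" if "z \<in> J" for z i
    using that
  proof (induction i)
    case (Suc i)
    then obtain k where "k \<in> J" "z = (N ^^ i) k" by auto
    moreover from this obtain l where "l \<in> J" "k = N l" using JJ2 by (auto simp: J2_def)
    ultimately show ?case by (auto simp: funpow_swap1)
  qed auto
  have J0: "z = 0" if "z \<in> J" for z
    using J_pow[OF that, of m] nil_a by (auto simp: N_def)
  show "bracket a x = a" using J0[OF fJ] by (simp add: f_def)
  show "bracket x a = - a" using J0[OF gJ] by (simp add: g_def eq_neg_iff_add_eq_0)
  show "bracket a a = 0" using J0[OF bJ] by (simp add: b_def)
qed

end

section \<open>Algebras with almost abelian Frattini quotient\<close>

context leibniz_algebra
begin

text \<open>\<open>A\<close> is the preimage of the abelian ideal of the quotient, so that all later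
  arguments run in the algebra itself.\<close>

lemma almost_abelian_quotientE:
  assumes I: "ideal I" and q: "almost_abelian_lie_algebra (quotient I)"
  obtains A y where "subspace A" "I \<subseteq> A" "\<not> A \<subseteq> I" "\<And>v. bracket v v \<in> I"
    "\<And>v. \<exists>a\<in>A. \<exists>c. v = a + scale c y"
    "\<And>a. a \<in> A \<Longrightarrow> bracket a y - a \<in> I \<and> bracket y a + a \<in> I"
    "\<And>a b. a \<in> A \<Longrightarrow> b \<in> A \<Longrightarrow> bracket a b \<in> I"
proof -
  have s: "subspace I" using I by (rule subspace_if_ideal)
  let ?Q = "quotient I"
  interpret Q: lie_algebra_on ?Q using q by (simp add: almost_abelian_lie_algebra_def)
  obtain B Y where B: "abelian_ideal_on ?Q B" "B \<noteq> {zer ?Q}" and Y: "Y \<in> carr ?Q"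
    and carr: "carr ?Q = {add ?Q a (smul ?Q c Y) | a c. a \<in> B}"
    and BY: "\<forall>a\<in>B. brk ?Q a Y = a \<and> brk ?Q Y a = smul ?Q (- 1) a"
    using q unfolding almost_abelian_lie_algebra_def by (elim conjE exE bexE)
  obtain y where y: "Y = y +o I" using Y by (auto simp: carr_quotient)
  have in_carr: "v +o I \<in> carr ?Q" for v unfolding carr_quotient by (rule rangeI)
  have B_carr: "\<exists>a. X = a +o I" if "X \<in> B" for X
    using that B(1) by (auto simp: abelian_ideal_on_def carr_quotient)
  have eq_zer: "v +o I = zer ?Q \<longleftrightarrow> v \<in> I" for v
    using coset_eq_iff[OF s, of v 0] by (simp only: zer_quotient diff_0_right)
  define A where "A = {a. a +o I \<in> B}"
  show thesis
  proof (rule that[of A y])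
    show "subspace A"
    proof (rule subspaceI)
      show "0 \<in> A" using B(1) by (simp add: A_def abelian_ideal_on_def zer_quotient)
      fix u v c assume "u \<in> A" "v \<in> A"
      then show "u + v \<in> A" "scale c u \<in> A"
        using B(1) unfolding A_def abelian_ideal_on_def
        by (auto simp flip: quotient_add[OF s] quotient_smul[OF s])
    qed
    show "I \<subseteq> A"
    proof
      fix v assume "v \<in> I"
      then have "v +o I = zer ?Q" by (simp only: eq_zer)
      then show "v \<in> A" using B(1) by (simp add: A_def abelian_ideal_on_def)
    qed
    obtain X where "X \<in> B" "X \<noteq> zer ?Q" using B by (auto simp: abelian_ideal_on_def)
    then show "\<not> A \<subseteq> I" using B_carr eq_zer by (fastforce simp: A_def)
    show "bracket v v \<in> I" for v
      using Q.brk_self[OF in_carr[of v]] by (simp only: quotient_brk[OF I] eq_zer)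
    show "\<exists>a\<in>A. \<exists>c. v = a + scale c y" for v
    proof -
      have "v +o I \<in> {add ?Q a (smul ?Q c Y) | a c. a \<in> B}"
        using in_carr[of v] by (simp only: carr)
      then obtain X c where X: "X \<in> B" "v +o I = add ?Q X (smul ?Q c Y)" by blast
      obtain a where a: "X = a +o I" using B_carr X(1) by blast
      have "v +o I = (a + scale c y) +o I"
        using X(2) by (simp only: a y quotient_add[OF s] quotient_smul[OF s])
      then have "v - (a + scale c y) \<in> I" by (simp only: coset_eq_iff[OF s])
      then have "(v - scale c y) - a \<in> I" by (simp add: algebra_simps)
      then have "(v - scale c y) +o I = a +o I" by (simp only: coset_eq_iff[OF s])
      then have "v - scale c y \<in> A" using X(1) by (simp add: A_def a)
      then show ?thesis by (intro bexI[of _ "v - scale c y"] exI[of _ c]) simp_all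
    qed
    show "bracket a y - a \<in> I \<and> bracket y a + a \<in> I" if "a \<in> A" for a
    proof -
      have "a +o I \<in> B" using that by (simp add: A_def)
      then have "bracket a y +o I = a +o I" "bracket y a +o I = scale (- 1) a +o I"
        using BY by (simp_all only: y quotient_smul[OF s] flip: quotient_brk[OF I])
      then show ?thesis by (simp add: coset_eq_iff[OF s])
    qed
    show "bracket a b \<in> I" if "a \<in> A" "b \<in> A" for a b
    proof -
      have "brk ?Q (a +o I) (b +o I) = zer ?Q"
        using that B(1) by (simp add: A_def abelian_ideal_on_def)
      then show ?thesis by (simp only: quotient_brk[OF I] eq_zer)
    qed
  qed
qed

text \<open>Each application of the derivation lowers one of the two exponents. Hence the Fitting
  null component of a right multiplication is a subalgebra.\<close>

lemma funpow_bracket_bracket: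
  assumes "((\<lambda>z. bracket z b) ^^ i) u = 0" "((\<lambda>z. bracket z b) ^^ j) v = 0"
  shows "((\<lambda>z. bracket z b) ^^ (i + j)) (bracket u v) = 0"
  using assms
proof (induction "i + j" arbitrary: i j u v)
  case 0
  then show ?case by simp
next
  case (Suc k)
  show ?case
  proof (cases "i = 0 \<or> j = 0")
    case True
    then show ?thesis using Suc.prems by (auto simp: funpow_bracket_zero)
  next
    case False
    then obtain i' j' where ij: "i = Suc i'" "j = Suc j'" by (auto simp: gr0_conv_Suc)
    have "((\<lambda>z. bracket z b) ^^ i') (bracket u b) = 0"
      using Suc.prems(1) unfolding ij(1) funpow_Suc_right by simp
    then have 1: "((\<lambda>z. bracket z b) ^^ (i' + j)) (bracket (bracket u b) v) = 0"
      using Suc.hyps(2) ij by (intro Suc.hyps(1)[OF _ _ Suc.prems(2)]) simp_all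
    have "((\<lambda>z. bracket z b) ^^ j') (bracket v b) = 0"
      using Suc.prems(2) unfolding ij(2) funpow_Suc_right by simp
    then have 2: "((\<lambda>z. bracket z b) ^^ (i + j')) (bracket u (bracket v b)) = 0"
      using Suc.hyps(2) ij by (intro Suc.hyps(1)[OF _ Suc.prems(1)]) simp_all
    have "i + j = Suc (i' + j)" "i + j' = i' + j" by (simp_all add: ij)
    then have "((\<lambda>z. bracket z b) ^^ (i + j)) (bracket u v) =
        ((\<lambda>z. bracket z b) ^^ (i' + j)) (bracket (bracket u v) b)"
      by (simp only: funpow_Suc_right o_apply)
    then show ?thesis
      using 1 2 \<open>i + j' = i' + j\<close> by (simp only: bracket_derivation[of u v b] funpow_bracket_add add_0)
  qed
qed

end

locale finite_dimensional_leibniz_algebra =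
  leibniz_algebra scale bracket + finite_dimensional_vector_space scale Basis
  for scale :: "'a::field \<Rightarrow> 'b::ab_group_add \<Rightarrow> 'b" and bracket Basis
begin

text \<open>A proper \<open>S\<close> would lie in a proper subalgebra of greatest dimension, which
  is maximal and therefore also contains the Frattini ideal.\<close>

lemma subalgebra_eq_UNIV:
  assumes S: "subalgebra S" and sum: "S + frattini_ideal = UNIV"
  shows "S = UNIV"
proof (rule ccontr)
  assume ne: "S \<noteq> UNIV"
  define P where "P U \<longleftrightarrow> subalgebra U \<and> U \<noteq> UNIV \<and> S \<subseteq> U" for U
  have "P S" using S ne by (simp add: P_def)
  moreover have "\<forall>U. P U \<longrightarrow> dim U < Suc dimension"
    by (metis dim_subset_UNIV le_imp_less_Suc)
  ultimately obtain M where M: "P M" and max: "\<And>U. P U \<Longrightarrow> dim U \<le> dim M"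
    using ex_has_greatest_nat[of P S dim] by blast
  have "U = M \<or> U = UNIV" if U: "subalgebra U" "M \<subseteq> U" for U
  proof (rule disjCI)
    assume "U \<noteq> UNIV"
    then have "P U" using U M by (auto simp: P_def)
    then have "dim U \<le> dim M" by (rule max)
    then show "U = M"
      using U M subspace_dim_equal[of M U] by (auto simp: P_def subspace_if_subalgebra)
  qed
  then have "maximal_subalgebra M" using M by (simp add: maximal_subalgebra_def P_def)
  then have "frattini_ideal \<subseteq> M" using frattini_ideal_greatest(2) by auto
  then have "S + frattini_ideal \<subseteq> M"
    using M by (intro set_plus_subset_subspace) (auto simp: P_def subspace_if_subalgebra)
  then show False using M sum by (auto simp: P_def)
qed

text \<open>The Fitting null component is a subalgebra, and \<open>b\<close> puts the complementary
  part into the Frattini ideal. So the null component is everything by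
  \<open>subalgebra_eq_UNIV\<close>.\<close>

lemma right_multiplication_nilpotent:
  assumes b: "\<And>z. bracket (bracket z b) b \<in> frattini_ideal"
  obtains m where "\<And>z. ((\<lambda>z. bracket z b) ^^ m) z = 0"
proof -
  define T where "T = (\<lambda>z. bracket z b)"
  define L where "L = {z. \<exists>i. (T ^^ i) z = 0}"
  have stay: "(T ^^ j) z = 0" if "(T ^^ i) z = 0" "i \<le> j" for i j z
    using that(2,1) by (induction rule: dec_induct) (simp_all add: T_def)
  have "subspace L"
  proof (rule subspaceI)
    show "0 \<in> L" by (auto simp: L_def intro: exI[of _ 0])
    fix u v c assume "u \<in> L" "v \<in> L"
    then obtain i j where "(T ^^ i) u = 0" "(T ^^ j) v = 0" by (auto simp: L_def)
    then have "(T ^^ max i j) (u + v) = 0" "(T ^^ i) (scale c u) = 0"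
      using stay[of i u "max i j"] stay[of j v "max i j"]
      by (simp_all add: T_def funpow_bracket_add funpow_bracket_scale)
    then show "u + v \<in> L" "scale c u \<in> L" by (auto simp: L_def)
  qed
  moreover have "bracket u v \<in> L" if "u \<in> L" "v \<in> L" for u v
    using that funpow_bracket_bracket[of _ b u _ v] unfolding L_def T_def by blast
  ultimately have L: "subalgebra L" by (simp add: subalgebra_def)
  obtain N where N: "N \<ge> 2" "\<And>v. v \<in> UNIV \<Longrightarrow> \<exists>w\<in>UNIV. (T ^^ N) (v - (T ^^ N) w) = 0"
    using fitting[of T UNIV] linear_bracket_left by (auto simp: T_def)
  have "v \<in> L + frattini_ideal" for v
  proof -
    obtain w where w: "(T ^^ N) (v - (T ^^ N) w) = 0" using N(2) by blast
    obtain k where k: "N = Suc (Suc k)" using N(1) by (intro that[of "N - 2"]) simp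
    have "(T ^^ N) w \<in> frattini_ideal" unfolding k using b by (simp add: T_def)
    moreover have "v - (T ^^ N) w \<in> L" using w by (auto simp: L_def)
    ultimately show ?thesis by (metis set_plus_intro diff_add_cancel)
  qed
  then have "L = UNIV" by (intro subalgebra_eq_UNIV[OF L] UNIV_eq_I[symmetric])
  then have "\<forall>z. \<exists>i. (T ^^ i) z = 0" by (auto simp: L_def)
  then obtain i where i: "\<And>z. (T ^^ i z) z = 0" by metis
  \<comment> \<open>The sum bounds the exponents of all basis vectors at once.\<close>
  define m where "m = (\<Sum>z\<in>Basis. i z)"
  have "(T ^^ m) z = 0" if "z \<in> Basis" for z
    using stay[OF i] member_le_sum[of z Basis i] that finite_Basis by (simp add: m_def)
  moreover have "subspace {z. (T ^^ m) z = 0}"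
    by (rule subspaceI) (simp_all add: T_def funpow_bracket_add funpow_bracket_scale funpow_bracket_zero)
  ultimately have "span Basis \<subseteq> {z. (T ^^ m) z = 0}"
    by (intro span_minimal) auto
  then show thesis
    using span_Basis by (intro that[of m]) (auto simp: T_def)
qed

lemma almost_abelian_extension_if:
  assumes two: "(2 :: 'a) \<noteq> 0"
    and wq: "\<And>U. subalgebra U \<Longrightarrow> weak_quasi_ideal U"
    and quot: "almost_abelian_lie_algebra (quotient frattini_ideal)"
  obtains A x n where "almost_abelian_extension scale bracket A x n"
proof -
  define F where "F = frattini_ideal"
  have F: "ideal F" unfolding F_def by (rule frattini_ideal_greatest)
  have sF: "subspace F" using F by (rule subspace_if_ideal)
  have wq': "bracket u v \<in> U + V" if "subalgebra U" "subalgebra V" "u \<in> U" "v \<in> V" for U V u v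
    using wq[OF that(1)] that(2-4) by (simp add: weak_quasi_ideal_iff)
  obtain B y where sB: "subspace B" and FB: "F \<subseteq> B" and BF: "\<not> B \<subseteq> F"
    and sq: "\<And>v. bracket v v \<in> F"
    and dec_y: "\<And>v. \<exists>a\<in>B. \<exists>c. v = a + scale c y"
    and By: "\<And>a. a \<in> B \<Longrightarrow> bracket a y - a \<in> F \<and> bracket y a + a \<in> F"
    and BB: "\<And>a b. a \<in> B \<Longrightarrow> b \<in> B \<Longrightarrow> bracket a b \<in> F"
    using almost_abelian_quotientE[OF F quot[folded F_def]] by metis
  \<comment> \<open>The Fitting null component of \<open>y\<close> differs from \<open>y\<close> by an element with zero right multiplication.\<close>
  obtain x n where x: "x - y \<in> tail y 2" and nil: "pow x (Suc n) = 0"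
  proof -
    have "(\<lambda>z. bracket z y) ` tail y 1 \<subseteq> tail y 1"
      using bracket_tail[of 1 _ y] tail_mono[of 1 2 y] by (auto simp: numeral_2_eq_2)
    then obtain N where N: "N \<ge> 2" and fit: "\<And>v. v \<in> tail y 1 \<Longrightarrow>
        \<exists>w\<in>tail y 1. ((\<lambda>z. bracket z y) ^^ N) (v - ((\<lambda>z. bracket z y) ^^ N) w) = 0"
      using fitting[OF linear_bracket_left[of y] subspace_tail] by metis
    obtain w where w: "w \<in> tail y 1"
      "((\<lambda>z. bracket z y) ^^ N) (y - ((\<lambda>z. bracket z y) ^^ N) w) = 0"
      using fit[OF self_in_tail] by blast
    define t where "t = ((\<lambda>z. bracket z y) ^^ N) w"
    have t: "t \<in> tail y 2"
      using funpow_bracket_tail[OF w(1), of N] tail_mono[of 2 "1 + N" y] N by (auto simp: t_def)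
    have "(\<lambda>z. bracket z (y - t)) = (\<lambda>z. bracket z y)"
      using t by (auto simp: bracket_simps bracket_tail_right)
    then have "pow (y - t) (Suc N) = 0" using w(2) by (simp add: pow_funpow t_def)
    moreover have "(y - t) - y \<in> tail y 2" using subspace_neg[OF subspace_tail t] by simp
    ultimately show thesis using that by blast
  qed
  have R: "bracket z x = bracket z y" for z
    using bracket_tail_right[OF x, of z] by (simp add: bracket_simps)
  have xF: "x - y \<in> F" using x tail_subset_ideal[OF F sq] by blast
  have Bx: "bracket a x - a \<in> F" "bracket x a + a \<in> F" if "a \<in> B" for a
  proof -
    show "bracket a x - a \<in> F" using By[OF that] by (simp add: R)
    have "bracket (x - y) a + (bracket y a + a) \<in> F"
      using By[OF that] by (intro subspace_add[OF sF ideal_bracket(1)[OF F xF]]) blast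
    then show "bracket x a + a \<in> F" by (simp add: bracket_simps algebra_simps)
  qed
  have dec: "\<exists>a\<in>B. \<exists>c. v = a + scale c x" for v
  proof -
    obtain a c where ac: "a \<in> B" "v = a + scale c y" using dec_y by blast
    have "a - scale c (x - y) \<in> B"
      using ac xF FB by (intro subspace_diff[OF sB ac(1) subspace_scale[OF sB]]) blast
    moreover have "v = (a - scale c (x - y)) + scale c x"
      using ac by (simp add: scale_right_diff_distrib)
    ultimately show ?thesis by blast
  qed
  have xB: "x \<notin> B"
  proof
    assume "x \<in> B"
    then have "bracket x x - (bracket x x - x) \<in> F"
      by (intro subspace_diff[OF sF sq] Bx(1))
    then have "x \<in> F" by simp
    have "a \<in> F" if a: "a \<in> B" for a
    proof -
      have "bracket a x - (bracket a x - a) \<in> F"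
        by (rule subspace_diff[OF sF ideal_bracket(2)[OF F \<open>x \<in> F\<close>] Bx(1)[OF a]])
      then show ?thesis by simp
    qed
    then show False using BF by blast
  qed
  have indep: "c = 0 \<and> d = 0" if a: "a \<in> B" "a \<notin> F" and cd: "scale c x + scale d a \<in> F" for a c d
  proof -
    have "c = 0"
    proof (rule ccontr)
      assume c: "c \<noteq> 0"
      have "scale c x + scale d a - scale d a \<in> B"
        using cd FB a by (intro subspace_diff[OF sB] subspace_scale[OF sB]) auto
      then have "scale c x \<in> B" by simp
      then have "scale (1 / c) (scale c x) \<in> B" by (rule subspace_scale[OF sB])
      then show False using c xB by simp
    qed
    moreover have "d = 0"
    proof (rule ccontr)
      assume d: "d \<noteq> 0"
      have "scale d a \<in> F" using cd \<open>c = 0\<close> by simp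
      then have "scale (1 / d) (scale d a) \<in> F" by (rule subspace_scale[OF sF])
      then show False using d a by simp
    qed
    ultimately show ?thesis ..
  qed
  have core: "bracket a x = a \<and> bracket x a = - a \<and> bracket a a = 0"
    if a: "a \<in> B" "a \<notin> F" and gen: "((\<lambda>z. bracket z x - z) ^^ M) a = 0" for a M
  proof -
    \<comment> \<open>Modulo \<open>F\<close>, \<open>bracket z a\<close> is a multiple of
      \<open>a\<close>, and squares lie in \<open>F\<close>.\<close>
    have "bracket (bracket z a) a \<in> F" for z
    proof -
      obtain b c where bc: "b \<in> B" "z = b + scale c x" using dec by blast
      have "bracket z a = bracket b a + scale c (bracket x a + a) - scale c a"
        using bc by (simp add: bracket_simps scale_right_distrib)
      then have "bracket (bracket z a) a =
          bracket (bracket b a + scale c (bracket x a + a)) a - scale c (bracket a a)"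
        by (simp add: bracket_simps)
      also have "\<dots> \<in> F"
        by (intro subspace_diff[OF sF] ideal_bracket(1)[OF F] subspace_scale[OF sF sq]
            subspace_add[OF sF BB[OF bc(1) a(1)] subspace_scale[OF sF Bx(2)[OF a(1)]]])
      finally show ?thesis .
    qed
    then obtain m where m: "\<And>z. ((\<lambda>z. bracket z a) ^^ m) z = 0"
      using right_multiplication_nilpotent[of a] unfolding F_def by metis
    note bracket_eq_if_weak_quasi_ideals[OF two wq' F Bx[OF a(1)] sq sq indep[OF a] nil m gen]
    then show ?thesis by blast
  qed
  define A where "A = {a \<in> B. bracket a x = a \<and> bracket x a = - a}"
  have sA: "subspace A"
    unfolding A_def
    by (rule subspaceI) (auto simp: bracket_simps subspace_0[OF sB] subspace_add[OF sB] subspace_scale[OF sB])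
  \<comment> \<open>The Fitting decomposition of \<open>D\<close> on \<open>B\<close> splits
    \<open>a\<close> into an element on which \<open>D\<close> is nilpotent, to which
    \<open>core\<close> applies unless \<open>a\<close> is in \<open>F\<close>, and a value of
    \<open>D\<close>, which lies in \<open>F\<close>.\<close>
  have B_sub: "B \<subseteq> A + F"
  proof
    fix a assume a: "a \<in> B"
    define D where "D = (\<lambda>z. bracket z x - z)"
    have DB: "D z \<in> F" if "z \<in> B" for z using Bx(1)[OF that] by (simp add: D_def)
    have "D ` B \<subseteq> B" using DB FB by blast
    moreover have "Vector_Spaces.linear scale scale D"
      unfolding D_def by (rule linear_bracket_left_diff)
    ultimately obtain N where N: "N \<ge> 2" "\<And>v. v \<in> B \<Longrightarrow> \<exists>w\<in>B. (D ^^ N) (v - (D ^^ N) w) = 0"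
      using fitting[OF _ sB] by metis
    obtain w where w: "w \<in> B" "(D ^^ N) (a - (D ^^ N) w) = 0" using N(2)[OF a] by blast
    obtain k where k: "N = Suc k" using N(1) by (cases N) auto
    have "(D ^^ k) w \<in> B" using DB FB w(1) by (intro funpow_mem) auto
    then have DF: "(D ^^ N) w \<in> F" using DB by (simp add: k)
    show "a \<in> A + F"
    proof (cases "a \<in> F")
      case True
      then show ?thesis using subspace_0[OF sA] by (metis add_0 set_plus_intro)
    next
      case False
      have "a - (D ^^ N) w \<in> B" using a DF FB by (intro subspace_diff[OF sB]) auto
      moreover have "a - (D ^^ N) w \<notin> F"
        using False DF subspace_add[OF sF, of "a - (D ^^ N) w" "(D ^^ N) w"] by auto
      ultimately have "a - (D ^^ N) w \<in> A"
        using core[of "a - (D ^^ N) w" N] w(2) by (simp add: A_def D_def)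
      then have "(a - (D ^^ N) w) + (D ^^ N) w \<in> A + F" using DF by (rule set_plus_intro)
      then show ?thesis by simp
    qed
  qed
  obtain a1 where a1: "a1 \<in> A" "a1 \<notin> F"
  proof -
    have "\<not> A \<subseteq> F" using B_sub BF set_plus_subset_subspace[OF sF, of A F] by blast
    then show thesis using that by blast
  qed
  \<comment> \<open>\<open>core\<close> covers only elements outside \<open>F\<close>. For
    \<open>a\<close> in \<open>F\<close> one polarises with \<open>a1 + a\<close> and
    \<open>a1 - a\<close>, which are outside, and divides by 2.\<close>
  have sq_A: "bracket a a = 0" if a: "a \<in> A" for a
  proof -
    have notF: "bracket a a = 0" if "a \<in> A" "a \<notin> F" for a
      using that core[of a 1] by (simp add: A_def)
    show ?thesis
    proof (cases "a \<in> F")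
      case True
      have "a1 + a \<notin> F" "a1 - a \<notin> F"
        using a1 True subspace_diff[OF sF, of "a1 + a" a] subspace_add[OF sF, of "a1 - a" a] by auto
      then have "bracket (a1 + a) (a1 + a) = 0" "bracket (a1 - a) (a1 - a) = 0" "bracket a1 a1 = 0"
        using notF a a1 subspace_add[OF sA] subspace_diff[OF sA] by auto
      moreover have "bracket a a + bracket a a = bracket (a1 + a) (a1 + a) + bracket (a1 - a) (a1 - a)
          - (bracket a1 a1 + bracket a1 a1)"
        by (simp add: bracket_simps)
      ultimately have "bracket a a + bracket a a = 0" by simp
      then have "scale 2 (bracket a a) = 0" using scale_left_distrib[of 1 1 "bracket a a"] by simp
      then show ?thesis using two by simp
    qed (use a notF in blast)
  qed
  \<comment> \<open>As squares vanish, the weak quasi-ideal property gives a linear combination of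
    \<open>a\<close> and \<open>b\<close>. On it right multiplication by \<open>x\<close> is the
    identity, but on the product it is doubling by the derivation rule.\<close>
  have AA: "bracket a b = 0" if ab: "a \<in> A" "b \<in> A" for a b
  proof -
    have mult: "\<exists>c. z = scale c a" if "a \<in> A" "z \<in> tail a 1" for z a
    proof -
      have "tail a 2 = {0}" using sq_A[OF that(1)] by (intro tail_eq_0[of a 2]) (simp_all add: pow_2)
      then show ?thesis using that(2) by (metis tail_1E add.right_neutral singletonD)
    qed
    have "bracket a b \<in> tail a 1 + tail b 1"
      by (intro wq' subalgebra_tail self_in_tail) auto
    then obtain c d where cd: "bracket a b = scale c a + scale d b"
      using mult ab by (metis set_plus_elim)
    have "bracket (bracket a b) x = bracket a b + bracket a b"
      using ab by (simp add: bracket_derivation A_def)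
    moreover have "bracket (bracket a b) x = bracket a b"
      using ab by (simp add: cd bracket_simps A_def)
    ultimately show ?thesis by simp
  qed
  interpret weight_one_subspace scale bracket A x
  proof unfold_locales
    show "subspace A" "abelian A" using sA AA by (simp_all add: abelian_def)
    show "bracket a x = a" "bracket x a = - a" if "a \<in> A" for a using that by (simp_all add: A_def)
  qed
  have "v \<in> A + tail x 1 + F" for v
  proof -
    obtain b c where bc: "b \<in> B" "v = b + scale c x" using dec by blast
    obtain a f where af: "a \<in> A" "f \<in> F" "b = a + f" using B_sub bc(1) by (blast elim: set_plus_elim)
    have "(a + scale c x) + f \<in> A + tail x 1 + F"
      using af self_in_tail[of x] by (intro set_plus_intro subspace_scale[OF subspace_tail])
    then show ?thesis using bc af by (simp add: algebra_simps)
  qed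
  then have sum: "A + tail x 1 = UNIV"
    unfolding F_def
    by (intro subalgebra_eq_UNIV[OF subalgebra_subspace_A(1)[OF sA order_refl]] UNIV_eq_I[symmetric])
  \<comment> \<open>Right multiplication by \<open>x\<close> fixes \<open>A\<close> pointwise and is
    nilpotent on \<open>tail x 1\<close>.\<close>
  have inter: "A \<inter> tail x 1 = {0}"
  proof -
    have "a = 0" if a: "a \<in> A" "a \<in> tail x 1" for a
    proof -
      have "((\<lambda>z. bracket z x) ^^ i) a = a" for i
        by (induction i) (use a in \<open>simp_all add: A_def\<close>)
      then show ?thesis
        using funpow_bracket_tail[OF a(2), of n] tail_eq_0[OF nil, of "1 + n"] by simp
    qed
    then show ?thesis using subspace_0[OF sA] subspace_0[OF subspace_tail] by blast
  qed
  have "almost_abelian_extension scale bracket A x (Suc n)"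
  proof unfold_locales
    show "A \<noteq> {0}" using a1 subspace_0[OF sF] by auto
  qed (use sum inter nil in auto)
  then show thesis by (rule that)
qed

end

theorem theorem3p6:
  fixes scale :: "'a::field \<Rightarrow> 'b::ab_group_add \<Rightarrow> 'b"
    and bracket :: "'b \<Rightarrow> 'b \<Rightarrow> 'b"
  assumes "CHAR('a) \<noteq> 2"
    and "\<forall>c::'a. \<exists>d. d ^ 2 = c"
    and "leibniz_algebra scale bracket"
    and "\<exists>B. finite_dimensional_vector_space scale B"
  shows "((\<forall>U. leibniz_algebra.subalgebra scale bracket U \<longrightarrow>
              leibniz_algebra.weak_quasi_ideal scale bracket U) \<and>
          almost_abelian_lie_algebra
            (leibniz_algebra.quotient scale bracket (leibniz_algebra.frattini_ideal scale bracket)))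
         \<longleftrightarrow>
         (\<exists>A x. leibniz_algebra.ideal scale bracket A \<and> leibniz_algebra.abelian bracket A \<and> A \<noteq> {0} \<and>
            A + leibniz_algebra.generated scale bracket {x} = UNIV \<and>
            A \<inter> leibniz_algebra.generated scale bracket {x} = {0} \<and>
            leibniz_algebra.cyclic scale bracket (leibniz_algebra.generated scale bracket {x}) \<and>
            leibniz_algebra.nilpotent scale bracket (leibniz_algebra.generated scale bracket {x}) \<and>
            (\<forall>a\<in>A. bracket a x = a \<and> bracket x a = - a) \<and>
            (\<forall>a\<in>A. \<forall>k>1. bracket (leibniz_algebra.pow bracket x k) a = 0 \<and>
                          bracket a (leibniz_algebra.pow bracket x k) = 0))"
    (is "?L \<longleftrightarrow> ?R")
proof -
  interpret leibniz_algebra scale bracket by fact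
  obtain B where "finite_dimensional_vector_space scale B" using assms(4) by blast
  then interpret fd: finite_dimensional_vector_space scale B .
  interpret finite_dimensional_leibniz_algebra scale bracket B by unfold_locales
  have two: "(2 :: 'a) \<noteq> 0"
  proof
    assume "(2 :: 'a) = 0"
    then have "CHAR('a) dvd 2" using of_nat_eq_0_iff_char_dvd[where 'a = 'a, of 2] by simp
    then have "CHAR('a) \<le> 2" "CHAR('a) \<noteq> 0" by (auto dest: dvd_imp_le intro!: Nat.gr0I)
    then show False using assms(1) CHAR_not_1[where 'a = 'a] by linarith
  qed
  show ?thesis
  proof
    assume L: ?L
    then obtain A x n where "almost_abelian_extension scale bracket A x n"
      using almost_abelian_extension_if[OF two] by blast
    then interpret E: almost_abelian_extension scale bracket A x n .
    show ?R
      using E.ideal_A E.abelian_A E.A_nonzero E.A_sum E.A_inter E.pow_n E.n_pos E.A_x E.x_A E.pow_A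
      unfolding nilpotent_generated_iff unfolding generated_singleton
      by (intro exI[of _ A] exI[of _ x])
        (auto simp: cyclic_def generated_singleton bracket_pow_right)
  next
    assume ?R
    then obtain A x where R: "ideal A" "abelian A" "A \<noteq> {0}" "A + generated {x} = UNIV"
      "A \<inter> generated {x} = {0}" "nilpotent (generated {x})"
      "\<And>a. a \<in> A \<Longrightarrow> bracket a x = a \<and> bracket x a = - a"
      by blast
    obtain n where n: "n \<ge> 1" "pow x n = 0" using R(6) by (auto simp: nilpotent_generated_iff)
    interpret E: almost_abelian_extension scale bracket A x n
      by unfold_locales (use R n in \<open>simp_all add: generated_singleton subspace_if_ideal\<close>)
    \<comment> \<open>Finite dimension enters the converse here, through the non-generator
      property.\<close>
    have "frattini_ideal = tail x 2" by (rule E.frattini_ideal_eq[OF subalgebra_eq_UNIV])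
    then show ?L
      using E.weak_quasi_ideal_if_subalgebra E.almost_abelian_quotient by simp
  qed
qed

end
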